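(* Let $f$ and $g$ be representable positive functionals on a (not necessarily unital) complex $^*$-algebra $\mathscr{A}$. Let $f_a$ denote the $g$-absolutely continuous part of $f$ and $g_a$ the $f$-absolutely continuous part of $g$ (as constructed in the context). Then $f_a$ and $g_a$ are absolutely continuous with respect to each other: $f_a\ll g_a$ and $g_a\ll f_a$.
   Context: A positive functional on a complex $^*$-algebra $\mathscr{A}$ is a linear functional $f:\mathscr{A}\to\mathbb{C}$ with $f(a^*a)\ge0$ for all $a\in\mathscr{A}$. It is called representable if (i) there is a constant $C\ge0$ with $|f(a)|^2\le C f(a^*a)$ for all $a\in\mathscr{A}$, and (ii) for every $a\in\mathscr{A}$ there is $\lambda_a\ge0$ with $f(b^*a^*ab)\le\lambda_a f(b^*b)$ for all $b\in\mathscr{A}$. (Equivalently: there are a Hilbert space $H$, a $^*$-representation $\pi$ of $\mathscr{A}$ by bounded operators on $H$ and a cyclic vector $\zeta\in H$ with $f(a)=(\pi(a)\zeta\,|\,\zeta)$ for all $a$.) Absolute continuity: $g$ is absolutely continuous with respect to $f$, written $g\ll f$, if for any sequence $(a_n)_{n\in\mathbb{N}}$ in $\mathscr{A}$, $f(a_n^*a_n)\to0$ and $g((a_n-a_m)^*(a_n-a_m))\to0$ (as $n,m\to\infty$) imply $g(a_n^*a_n)\to0$. GNS construction. $\bar{\mathscr{A}}^*$ denotes the vector space of all antilinear functionals $\mathscr{A}\to\mathbb{C}$. Given a representable positive functional $f$, its associated positive operator is the linear map $A:\mathscr{A}\to\bar{\mathscr{A}}^*$, $(Aa)(x):=f(x^*a)$.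 The range $\operatorname{ran}A$ carries the well-defined inner product $(Aa\,|\,Ab)_A:=f(b^*a)$, and $H_A$ is its Hilbert space completion (inner products are linear in the first variable). For $x\in\mathscr{A}$, $\pi_A(x)$ is the bounded operator on $H_A$ that is the continuous extension of $Aa\mapsto A(xa)$; $\pi_A$ is a $^*$-representation of $\mathscr{A}$ on $H_A$. The vector $\zeta_A\in H_A$ is the unique vector with $f(a)=(Aa\,|\,\zeta_A)_A$ for all $a\in\mathscr{A}$; it is cyclic for $\pi_A$, and $\pi_A(a)\zeta_A=Aa$, $f(a)=(\pi_A(a)\zeta_A\,|\,\zeta_A)_A$ for all $a\in\mathscr{A}$. The triplet $(H_B,\pi_B,\zeta_B)$, operator $B$, and inner product $(\cdot\,|\,\cdot)_B$ are obtained in the same way from $g$. Absolutely continuous parts. Let $$\mathfrak{M}:=\{\zeta\in H_B \mid \exists\,(a_n)_{n\in\mathbb{N}}\subseteq\mathscr{A}:\ (Aa_n\,|\,Aa_n)_A\to0,\ Ba_n\to\zeta \text{ in } H_B\},$$ a closed linear subspace of $H_B$, and let $Q$ be the orthogonal projection of $H_B$ onto $\mathfrak{M}$. The $f$-absolutely continuous part of $g$ is the functional $$g_a(x):=(\pi_B(x)(I-Q)\zeta_B\,|\,(I-Q)\zeta_B)_B,\qquad x\in\mathscr{A}.$$ Symmetrically, let $$\mathfrak{N}:=\{\xi\in H_A \mid \exists\,(a_n)_{n\in\mathbb{N}}\subseteq\mathscr{A}:\ (Ba_n\,|\,Ba_n)_B\to0,\ Aa_n\to\xi \text{ in } H_A\},$$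 a closed linear subspace of $H_A$, and let $P$ be the orthogonal projection of $H_A$ onto $\mathfrak{N}$. The $g$-absolutely continuous part of $f$ is the functional $$f_a(x):=(\pi_A(x)(I-P)\zeta_A\,|\,(I-P)\zeta_A)_A,\qquad x\in\mathscr{A}.$$ Both $f_a$ and $g_a$ are representable positive functionals on $\mathscr{A}$. The subscript $a$ in $f_a,g_a$ is a mere label, not an element of $\mathscr{A}$. *)

theory Defs
  imports "HOL-Analysis.Analysis" "HOL-Library.Function_Algebras"
begin

section \<open>Complex *-algebras and positive functionals\<close>

text \<open>The algebra is not assumed to have a unit.\<close>

class complex_star_algebra = ring +
  fixes scaleC :: "complex \<Rightarrow> 'a \<Rightarrow> 'a"  (infixr "*\<^sub>C" 75)
    and star :: "'a \<Rightarrow> 'a"  ("_\<^sup>\<star>" [1000] 1000)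
  assumes scaleC_add_right: "c *\<^sub>C (a + b) = c *\<^sub>C a + c *\<^sub>C b"
    and scaleC_add_left: "(c + d) *\<^sub>C a = c *\<^sub>C a + d *\<^sub>C a"
    and scaleC_scaleC: "c *\<^sub>C d *\<^sub>C a = (c * d) *\<^sub>C a"
    and scaleC_one: "1 *\<^sub>C a = a"
    and mult_scaleC_left: "(c *\<^sub>C a) * b = c *\<^sub>C (a * b)"
    and mult_scaleC_right: "a * (c *\<^sub>C b) = c *\<^sub>C (a * b)"
    and star_add: "(a + b)\<^sup>\<star> = a\<^sup>\<star> + b\<^sup>\<star>"
    and star_scaleC: "(c *\<^sub>C a)\<^sup>\<star> = cnj c *\<^sub>C a\<^sup>\<star>"
    and star_mult: "(a * b)\<^sup>\<star> = b\<^sup>\<star> * a\<^sup>\<star>"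
    and star_star: "(a\<^sup>\<star>)\<^sup>\<star> = a"

definition complex_linear :: "('a::complex_star_algebra \<Rightarrow> complex) \<Rightarrow> bool" where
  "complex_linear f \<longleftrightarrow> (\<forall>a b. f (a + b) = f a + f b) \<and> (\<forall>c a. f (c *\<^sub>C a) = c * f a)"

definition positive_functional :: "('a::complex_star_algebra \<Rightarrow> complex) \<Rightarrow> bool" where
  "positive_functional f \<longleftrightarrow> complex_linear f \<and> (\<forall>a. f (a\<^sup>\<star> * a) \<in> \<real>\<^sub>\<ge>\<^sub>0)"

text \<open>
  By positivity, both arguments of \<^const>\<open>Re\<close> below are values of \<open>f\<close> that are already
  real: \<open>b\<^sup>\<star> * a\<^sup>\<star> * a * b = (a * b)\<^sup>\<star> * (a * b)\<close>.
\<close>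

definition representable :: "('a::complex_star_algebra \<Rightarrow> complex) \<Rightarrow> bool" where
  "representable f \<longleftrightarrow> positive_functional f \<and>
     (\<exists>C\<ge>0. \<forall>a. (cmod (f a))\<^sup>2 \<le> C * Re (f (a\<^sup>\<star> * a))) \<and>
     (\<forall>a. \<exists>l\<ge>0. \<forall>b. Re (f (b\<^sup>\<star> * a\<^sup>\<star> * a * b)) \<le> l * Re (f (b\<^sup>\<star> * b)))"

definition absolutely_continuous_wrt ::
    "('a::complex_star_algebra \<Rightarrow> complex) \<Rightarrow> ('a \<Rightarrow> complex) \<Rightarrow> bool"  (infix "\<lless>" 50) where
  "g \<lless> f \<longleftrightarrow> (\<forall>a :: nat \<Rightarrow> 'a.
      (\<lambda>n. f ((a n)\<^sup>\<star> * a n)) \<longlonglongrightarrow> 0 \<longrightarrow>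
      ((\<lambda>(n, m). g ((a n - a m)\<^sup>\<star> * (a n - a m))) \<longlongrightarrow> 0) (sequentially \<times>\<^sub>F sequentially) \<longrightarrow>
      (\<lambda>n. g ((a n)\<^sup>\<star> * a n)) \<longlonglongrightarrow> 0)"


section \<open>Inner product spaces of functions and their completion\<close>

text \<open>
  All spaces below are subspaces of the complex vector space of functions \<open>'x \<Rightarrow> complex\<close>
  with pointwise operations; inner products are linear in the first variable and are only
  meaningful on the carrier.
\<close>

definition fscale :: "complex \<Rightarrow> ('x \<Rightarrow> complex) \<Rightarrow> ('x \<Rightarrow> complex)" where
  "fscale c u = (\<lambda>x. c * u x)"

type_synonym 'x inner_prod = "('x \<Rightarrow> complex) \<Rightarrow> ('x \<Rightarrow> complex) \<Rightarrow> complex"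

definition ip_norm :: "'x inner_prod \<Rightarrow> ('x \<Rightarrow> complex) \<Rightarrow> real" where
  "ip_norm ip u = sqrt (Re (ip u u))"

definition ip_tendsto :: "'x inner_prod \<Rightarrow> (nat \<Rightarrow> 'x \<Rightarrow> complex) \<Rightarrow> ('x \<Rightarrow> complex) \<Rightarrow> bool" where
  "ip_tendsto ip u v \<longleftrightarrow> (\<lambda>n. ip_norm ip (u n - v)) \<longlonglongrightarrow> 0"

definition ip_Cauchy :: "'x inner_prod \<Rightarrow> (nat \<Rightarrow> 'x \<Rightarrow> complex) \<Rightarrow> bool" where
  "ip_Cauchy ip u \<longleftrightarrow> (\<forall>e>0. \<exists>N. \<forall>m\<ge>N. \<forall>n\<ge>N. ip_norm ip (u m - u n) < e)"

locale complex_inner_product_space =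
  fixes V :: "('x \<Rightarrow> complex) set" and ip :: "'x inner_prod"
  assumes zero_mem: "0 \<in> V"
    and add_mem: "u \<in> V \<Longrightarrow> v \<in> V \<Longrightarrow> u + v \<in> V"
    and fscale_mem: "u \<in> V \<Longrightarrow> fscale c u \<in> V"
    and ip_add: "u \<in> V \<Longrightarrow> v \<in> V \<Longrightarrow> w \<in> V \<Longrightarrow> ip (u + v) w = ip u w + ip v w"
    and ip_fscale: "u \<in> V \<Longrightarrow> w \<in> V \<Longrightarrow> ip (fscale c u) w = c * ip u w"
    and ip_cnj: "u \<in> V \<Longrightarrow> w \<in> V \<Longrightarrow> ip w u = cnj (ip u w)"
    and ip_nonneg: "u \<in> V \<Longrightarrow> 0 \<le> Re (ip u u)"
    and ip_definite: "u \<in> V \<Longrightarrow> ip u u = 0 \<Longrightarrow> u = 0"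

locale complex_hilbert_space = complex_inner_product_space +
  assumes complete: "(\<And>n. u n \<in> V) \<Longrightarrow> ip_Cauchy ip u \<Longrightarrow> \<exists>v\<in>V. ip_tendsto ip u v"

locale hilbert_completion =
  complex_inner_product_space V ip + H: complex_hilbert_space H ipH
  for V :: "('x \<Rightarrow> complex) set" and ip and H and ipH +
  assumes subset: "V \<subseteq> H"
    and extends: "u \<in> V \<Longrightarrow> v \<in> V \<Longrightarrow> ipH u v = ip u v"
    and dense: "h \<in> H \<Longrightarrow> \<exists>u. (\<forall>n::nat. u n \<in> V) \<and> ip_tendsto ipH u h"

text \<open>
  If the evaluation functionals are bounded on \<open>V\<close> and every Cauchy sequence of \<open>V\<close> that tends
  to \<open>0\<close> pointwise also tends to \<open>0\<close> in norm, then the abstract completion of \<open>V\<close> is realised by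
  the pointwise limits of Cauchy sequences; see \<open>gns_space_completion\<close> below for the
  case at hand.
\<close>

definition represents ::
    "('x \<Rightarrow> complex) set \<Rightarrow> 'x inner_prod \<Rightarrow> (nat \<Rightarrow> 'x \<Rightarrow> complex) \<Rightarrow> ('x \<Rightarrow> complex) \<Rightarrow> bool" where
  "represents V ip u h \<longleftrightarrow>
     (\<forall>n. u n \<in> V) \<and> ip_Cauchy ip u \<and> (\<forall>x. (\<lambda>n. u n x) \<longlonglongrightarrow> h x)"

definition fn_completion :: "('x \<Rightarrow> complex) set \<Rightarrow> 'x inner_prod \<Rightarrow> ('x \<Rightarrow> complex) set" where
  "fn_completion V ip = {h. \<exists>u. represents V ip u h}"

definition completion_ip :: "('x \<Rightarrow> complex) set \<Rightarrow> 'x inner_prod \<Rightarrow> 'x inner_prod" where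
  "completion_ip V ip h k =
     (THE c. \<forall>u v. represents V ip u h \<longrightarrow> represents V ip v k \<longrightarrow> (\<lambda>n. ip (u n) (v n)) \<longlonglongrightarrow> c)"

definition bounded_operator_on ::
    "('x \<Rightarrow> complex) set \<Rightarrow> 'x inner_prod \<Rightarrow> (('x \<Rightarrow> complex) \<Rightarrow> ('x \<Rightarrow> complex)) \<Rightarrow> bool" where
  "bounded_operator_on H ip T \<longleftrightarrow>
     (\<forall>h\<in>H. T h \<in> H) \<and>
     (\<forall>h\<in>H. \<forall>k\<in>H. T (h + k) = T h + T k) \<and>
     (\<forall>c. \<forall>h\<in>H. T (fscale c h) = fscale c (T h)) \<and>
     (\<exists>K. \<forall>h\<in>H. ip_norm ip (T h) \<le> K * ip_norm ip h)"

definition orth_projection ::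
    "'x inner_prod \<Rightarrow> ('x \<Rightarrow> complex) set \<Rightarrow> ('x \<Rightarrow> complex) \<Rightarrow> ('x \<Rightarrow> complex)" where
  "orth_projection ip M h = (THE m. m \<in> M \<and> (\<forall>k\<in>M. ip (h - m) k = 0))"


section \<open>The GNS construction\<close>

text \<open>The functions \<open>assoc_op f a\<close> are antilinear, and so are their pointwise limits.\<close>

definition assoc_op :: "('a::complex_star_algebra \<Rightarrow> complex) \<Rightarrow> 'a \<Rightarrow> ('a \<Rightarrow> complex)" where
  "assoc_op f a = (\<lambda>x. f (x\<^sup>\<star> * a))"

definition ran_ip :: "('a::complex_star_algebra \<Rightarrow> complex) \<Rightarrow> 'a inner_prod" where
  "ran_ip f u v = (THE c. \<exists>a b. u = assoc_op f a \<and> v = assoc_op f b \<and> c = f (b\<^sup>\<star> * a))"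

definition gns_space :: "('a::complex_star_algebra \<Rightarrow> complex) \<Rightarrow> ('a \<Rightarrow> complex) set" where
  "gns_space f = fn_completion (range (assoc_op f)) (ran_ip f)"

definition gns_ip :: "('a::complex_star_algebra \<Rightarrow> complex) \<Rightarrow> 'a inner_prod" where
  "gns_ip f = completion_ip (range (assoc_op f)) (ran_ip f)"

text \<open>Membership in the extensional function space only fixes the value outside \<open>gns_space f\<close>.\<close>

definition gns_rep ::
    "('a::complex_star_algebra \<Rightarrow> complex) \<Rightarrow> 'a \<Rightarrow> (('a \<Rightarrow> complex) \<Rightarrow> ('a \<Rightarrow> complex))" where
  "gns_rep f x = (THE T. T \<in> gns_space f \<rightarrow>\<^sub>E gns_space f \<and>
     bounded_operator_on (gns_space f) (gns_ip f) T \<and>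
     (\<forall>a. T (assoc_op f a) = assoc_op f (x * a)))"

definition gns_vector :: "('a::complex_star_algebra \<Rightarrow> complex) \<Rightarrow> ('a \<Rightarrow> complex)" where
  "gns_vector f = (THE z. z \<in> gns_space f \<and> (\<forall>a. f a = gns_ip f (assoc_op f a) z))"


section \<open>Absolutely continuous parts\<close>

text \<open>
  \<open>singular_subspace f g\<close> is the subspace \<open>\<MM>\<close> of the GNS space of \<open>g\<close>; the subspace \<open>\<NN>\<close> of
  the GNS space of \<open>f\<close> is \<open>singular_subspace g f\<close>.
\<close>

definition singular_subspace ::
    "('a::complex_star_algebra \<Rightarrow> complex) \<Rightarrow> ('a \<Rightarrow> complex) \<Rightarrow> ('a \<Rightarrow> complex) set" where
  "singular_subspace f g = {z \<in> gns_space g. \<exists>a :: nat \<Rightarrow> 'a.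
     (\<lambda>n. gns_ip f (assoc_op f (a n)) (assoc_op f (a n))) \<longlonglongrightarrow> 0 \<and>
     ip_tendsto (gns_ip g) (\<lambda>n. assoc_op g (a n)) z}"

text \<open>\<open>ac_part f g\<close> is the \<open>f\<close>-absolutely continuous part of \<open>g\<close>.\<close>

definition ac_part ::
    "('a::complex_star_algebra \<Rightarrow> complex) \<Rightarrow> ('a \<Rightarrow> complex) \<Rightarrow> ('a \<Rightarrow> complex)" where
  "ac_part f g x =
     (let z = gns_vector g - orth_projection (gns_ip g) (singular_subspace f g) (gns_vector g)
      in gns_ip g (gns_rep g x z) z)"

section \<open>The GNS space is the Hilbert space completion of the range\<close>

context complex_inner_product_space
begin

lemma fscale_minus_one: "fscale (- 1) u = - u"
  by (auto simp: fscale_def fun_eq_iff)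

lemma uminus_mem: "u \<in> V \<Longrightarrow> - u \<in> V"
  using fscale_mem[of u "- 1"] by (simp add: fscale_minus_one)

lemma diff_mem: "u \<in> V \<Longrightarrow> v \<in> V \<Longrightarrow> u - v \<in> V"
  using add_mem[of u "- v"] uminus_mem[of v] by simp

lemma ip_uminus: "u \<in> V \<Longrightarrow> w \<in> V \<Longrightarrow> ip (- u) w = - ip u w"
  using ip_fscale[of u w "- 1"] by (simp add: fscale_minus_one)

lemma ip_diff: "u \<in> V \<Longrightarrow> v \<in> V \<Longrightarrow> w \<in> V \<Longrightarrow> ip (u - v) w = ip u w - ip v w"
  using ip_add[of u "- v" w] ip_uminus[of v w] uminus_mem[of v] by simp

lemma ip_add_right: "u \<in> V \<Longrightarrow> v \<in> V \<Longrightarrow> w \<in> V \<Longrightarrow> ip w (u + v) = ip w u + ip w v"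
  using ip_add[of u v w] ip_cnj[of "u + v" w] ip_cnj[of u w] ip_cnj[of v w] add_mem[of u v]
  by simp

lemma ip_diff_right: "u \<in> V \<Longrightarrow> v \<in> V \<Longrightarrow> w \<in> V \<Longrightarrow> ip w (u - v) = ip w u - ip w v"
  using ip_diff[of u v w] ip_cnj[of "u - v" w] ip_cnj[of u w] ip_cnj[of v w] diff_mem[of u v]
  by simp

lemma ip_fscale_right: "u \<in> V \<Longrightarrow> w \<in> V \<Longrightarrow> ip w (fscale c u) = cnj c * ip w u"
  using ip_fscale[of u w c] ip_cnj[of "fscale c u" w] ip_cnj[of u w] fscale_mem[of u c]
  by simp

lemma ip_real: "u \<in> V \<Longrightarrow> ip u u = of_real (Re (ip u u))"
  using ip_cnj[of u u] by (simp add: complex_eq_iff)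

lemma ip_self: "u \<in> V \<Longrightarrow> ip u u = of_real ((ip_norm ip u)\<^sup>2)"
  using ip_real[of u] ip_nonneg[of u] by (simp add: ip_norm_def)

lemma ip_norm_nonneg: "u \<in> V \<Longrightarrow> 0 \<le> ip_norm ip u"
  using ip_nonneg[of u] by (simp add: ip_norm_def)

lemma ip_norm_eq_0: "u \<in> V \<Longrightarrow> ip_norm ip u = 0 \<Longrightarrow> u = 0"
  using ip_self[of u] ip_definite[of u] by simp

lemma Cauchy_Schwarz:
  assumes "u \<in> V" "v \<in> V"
  shows "cmod (ip u v) \<le> ip_norm ip u * ip_norm ip v"
proof (cases "v = 0")
  case True
  have "ip u (v - v) = 0"
    using ip_diff_right[of v v u] assms by simp
  then show ?thesis
    using True ip_norm_nonneg assms by simp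
next
  case False
  define q where "q = Re (ip v v)"
  have q: "ip v v = of_real q" "q > 0"
    using ip_real[of v] ip_definite[of v] ip_nonneg[of v] False assms
    by (auto simp: q_def less_le)
  define p where "p = Re (ip u u)"
  have p: "ip u u = of_real p"
    using ip_real[of u] assms by (simp add: p_def)
  let ?c = "ip u v / of_real q"
  let ?w = "u - fscale ?c v"
  have mem: "fscale ?c v \<in> V"
    by (rule fscale_mem) (use assms in auto)
  have w: "?w \<in> V"
    by (rule diff_mem) (use assms mem in auto)
  have "ip ?w ?w = ip u u - ip u (fscale ?c v) - (ip (fscale ?c v) u - ip (fscale ?c v) (fscale ?c v))"
    using assms mem w by (simp add: ip_diff ip_diff_right)
  also have "\<dots> = of_real p - cnj ?c * ip u v - (?c * cnj (ip u v) - ?c * (cnj ?c * of_real q))"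
    using assms mem p q(1) ip_cnj[of u v]
    by (simp add: ip_fscale ip_fscale_right)
  also have "\<dots> = of_real p - (ip u v * cnj (ip u v)) / of_real q"
    using q(2) by (simp add: field_simps)
  also have "\<dots> = of_real (p - (cmod (ip u v))\<^sup>2 / q)"
    by (simp add: complex_norm_square[symmetric])
  finally have "0 \<le> p - (cmod (ip u v))\<^sup>2 / q"
    using ip_nonneg[OF w] by (metis Re_complex_of_real)
  then have "(cmod (ip u v))\<^sup>2 \<le> p * q"
    using q(2) by (simp add: field_simps)
  then have "cmod (ip u v) \<le> sqrt (p * q)"
    by (rule real_le_rsqrt)
  then show ?thesis
    by (simp add: ip_norm_def p_def q_def real_sqrt_mult)
qed

lemma ip_norm_triangle:
  assumes "u \<in> V" "v \<in> V"
  shows "ip_norm ip (u + v) \<le> ip_norm ip u + ip_norm ip v"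
proof (rule power2_le_imp_le)
  have "of_real ((ip_norm ip (u + v))\<^sup>2) = ip (u + v) (u + v)"
    using ip_self[of "u + v"] add_mem assms by simp
  also have "\<dots> = ip u u + ip u v + (cnj (ip u v) + ip v v)"
    using assms add_mem[of u v] ip_cnj[of u v] by (simp add: ip_add ip_add_right)
  finally have "(ip_norm ip (u + v))\<^sup>2 = Re (ip u u + ip u v + (cnj (ip u v) + ip v v))"
    by (metis Re_complex_of_real)
  also have "\<dots> = (ip_norm ip u)\<^sup>2 + 2 * Re (ip u v) + (ip_norm ip v)\<^sup>2"
    using assms ip_nonneg by (simp add: ip_norm_def)
  also have "\<dots> \<le> (ip_norm ip u)\<^sup>2 + 2 * (ip_norm ip u * ip_norm ip v) + (ip_norm ip v)\<^sup>2"
    using Cauchy_Schwarz[OF assms] complex_Re_le_cmod[of "ip u v"] by linarith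
  finally show "(ip_norm ip (u + v))\<^sup>2 \<le> (ip_norm ip u + ip_norm ip v)\<^sup>2"
    by (simp add: power2_sum)
  show "0 \<le> ip_norm ip u + ip_norm ip v"
    using ip_norm_nonneg assms by simp
qed

lemma ip_norm_fscale: "u \<in> V \<Longrightarrow> ip_norm ip (fscale c u) = cmod c * ip_norm ip u"
proof -
  assume u: "u \<in> V"
  have "ip (fscale c u) (fscale c u) = c * cnj c * ip u u"
    using u fscale_mem[OF u] by (simp add: ip_fscale ip_fscale_right)
  also have "\<dots> = of_real ((cmod c)\<^sup>2 * Re (ip u u))"
    using ip_real[OF u] by (metis complex_norm_square of_real_mult)
  finally show ?thesis
    by (simp add: ip_norm_def real_sqrt_mult)
qed

lemma ip_norm_minus_commute: "u \<in> V \<Longrightarrow> v \<in> V \<Longrightarrow> ip_norm ip (u - v) = ip_norm ip (v - u)"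
  using ip_norm_fscale[of "u - v" "- 1"] diff_mem[of u v] by (simp add: fscale_minus_one)

lemma ip_norm_diff_triangle:
  assumes "u \<in> V" "v \<in> V" "w \<in> V"
  shows "ip_norm ip (u - w) \<le> ip_norm ip (u - v) + ip_norm ip (v - w)"
  using ip_norm_triangle[of "u - v" "v - w"] diff_mem assms by simp

lemma ip_norm_le_diff:
  assumes "u \<in> V" "v \<in> V"
  shows "ip_norm ip u \<le> ip_norm ip (u - v) + ip_norm ip v"
  using ip_norm_triangle[of "u - v" v] diff_mem assms by simp

lemma Cauchy_bounded:
  assumes u: "\<And>n. u n \<in> V" and C: "ip_Cauchy ip u"
  obtains B where "B > 0" "\<And>n. ip_norm ip (u n) \<le> B"
proof -
  obtain N where N: "\<And>m n. m \<ge> N \<Longrightarrow> n \<ge> N \<Longrightarrow> ip_norm ip (u m - u n) < 1"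
    using C unfolding ip_Cauchy_def by (meson zero_less_one)
  define B where "B = 1 + ip_norm ip (u N) + (\<Sum>n<N. ip_norm ip (u n))"
  have nn: "0 \<le> ip_norm ip (u n)" for n
    using ip_norm_nonneg u by blast
  have s: "0 \<le> (\<Sum>n<N. ip_norm ip (u n))"
    by (simp add: nn sum_nonneg)
  have "ip_norm ip (u n) \<le> B" for n
  proof (cases "n < N")
    case True
    then have "ip_norm ip (u n) \<le> (\<Sum>n<N. ip_norm ip (u n))"
      by (intro member_le_sum) (auto simp: nn)
    then show ?thesis
      using nn[of N] by (simp add: B_def)
  next
    case False
    then show ?thesis
      using ip_norm_le_diff[OF u u, of n N] N[of n N] s by (simp add: B_def)
  qed
  moreover have "B > 0"
    using s nn[of N] by (simp add: B_def)
  ultimately show ?thesis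
    using that by blast
qed

lemma ip_Cauchy_diff:
  assumes "\<And>n. u n \<in> V" "ip_Cauchy ip u" "\<And>n. v n \<in> V" "ip_Cauchy ip v"
  shows "ip_Cauchy ip (\<lambda>n. u n - v n)"
  unfolding ip_Cauchy_def
proof (intro allI impI)
  fix e :: real
  assume "e > 0"
  then have "e / 2 > 0" by simp
  then obtain M N where M: "\<And>m n. m \<ge> M \<Longrightarrow> n \<ge> M \<Longrightarrow> ip_norm ip (u m - u n) < e / 2"
    and N: "\<And>m n. m \<ge> N \<Longrightarrow> n \<ge> N \<Longrightarrow> ip_norm ip (v m - v n) < e / 2"
    using assms(2,4) unfolding ip_Cauchy_def by meson
  have "ip_norm ip (u m - v m - (u n - v n)) < e" if "m \<ge> max M N" "n \<ge> max M N" for m n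
  proof -
    have "ip_norm ip (u m - v m - (u n - v n)) = ip_norm ip ((u m - u n) + (v n - v m))"
      by (simp add: algebra_simps)
    also have "\<dots> \<le> ip_norm ip (u m - u n) + ip_norm ip (v n - v m)"
      by (intro ip_norm_triangle diff_mem assms)
    finally show ?thesis
      using M[of m n] N[of n m] that by simp
  qed
  then show "\<exists>N. \<forall>m\<ge>N. \<forall>n\<ge>N. ip_norm ip (u m - v m - (u n - v n)) < e"
    by blast
qed

lemma ip_Cauchy_fscale:
  assumes "\<And>n. u n \<in> V" "ip_Cauchy ip u"
  shows "ip_Cauchy ip (\<lambda>n. fscale c (u n))"
  unfolding ip_Cauchy_def
proof (intro allI impI)
  fix e :: real
  assume "e > 0"
  then have "e / (cmod c + 1) > 0"
    by (simp add: add_nonneg_pos)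
  then obtain N where N: "\<And>m n. m \<ge> N \<Longrightarrow> n \<ge> N \<Longrightarrow> ip_norm ip (u m - u n) < e / (cmod c + 1)"
    using assms(2) unfolding ip_Cauchy_def by meson
  have "ip_norm ip (fscale c (u m) - fscale c (u n)) < e" if "m \<ge> N" "n \<ge> N" for m n
  proof -
    have "fscale c (u m) - fscale c (u n) = fscale c (u m - u n)"
      by (simp add: fscale_def fun_eq_iff algebra_simps)
    then have "ip_norm ip (fscale c (u m) - fscale c (u n)) = cmod c * ip_norm ip (u m - u n)"
      using ip_norm_fscale diff_mem assms(1) by simp
    also have "\<dots> \<le> (cmod c + 1) * ip_norm ip (u m - u n)"
      using ip_norm_nonneg[OF diff_mem[OF assms(1) assms(1)]] by (simp add: mult_right_mono)
    also have "\<dots> < e"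
      using N[OF that] by (simp add: pos_less_divide_eq add_nonneg_pos mult.commute)
    finally show ?thesis .
  qed
  then show "\<exists>N. \<forall>m\<ge>N. \<forall>n\<ge>N. ip_norm ip (fscale c (u m) - fscale c (u n)) < e"
    by blast
qed

lemma ip_Cauchy_const: "u \<in> V \<Longrightarrow> ip_Cauchy ip (\<lambda>n. u)"
  using ip_self[of "u - u"] ip_diff[of u u "u - u"] diff_mem[of u u]
  by (auto simp: ip_Cauchy_def)

lemma Cauchy_ip_Cauchy:
  assumes "\<And>n. u n \<in> V" "ip_Cauchy ip u" "\<And>n. v n \<in> V" "ip_Cauchy ip v"
  shows "Cauchy (\<lambda>n. ip (u n) (v n))"
proof (rule metric_CauchyI)
  fix e :: real
  assume "e > 0"
  obtain B where B: "B > 0" "\<And>n. ip_norm ip (u n) \<le> B"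
    using Cauchy_bounded[OF assms(1,2)] by metis
  obtain C where C: "C > 0" "\<And>n. ip_norm ip (v n) \<le> C"
    using Cauchy_bounded[OF assms(3,4)] by metis
  have "e / (2 * C) > 0" "e / (2 * B) > 0"
    using \<open>e > 0\<close> B C by auto
  then obtain M N where M: "\<And>m n. m \<ge> M \<Longrightarrow> n \<ge> M \<Longrightarrow> ip_norm ip (u m - u n) < e / (2 * C)"
    and N: "\<And>m n. m \<ge> N \<Longrightarrow> n \<ge> N \<Longrightarrow> ip_norm ip (v m - v n) < e / (2 * B)"
    using assms(2,4) unfolding ip_Cauchy_def by meson
  have "dist (ip (u m) (v m)) (ip (u n) (v n)) < e" if "m \<ge> max M N" "n \<ge> max M N" for m n
  proof -
    have "ip (u m) (v m) - ip (u n) (v n) = ip (u m - u n) (v m) + ip (u n) (v m - v n)"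
      using assms by (simp add: ip_diff ip_diff_right)
    then have "cmod (ip (u m) (v m) - ip (u n) (v n))
        \<le> cmod (ip (u m - u n) (v m)) + cmod (ip (u n) (v m - v n))"
      by (metis norm_triangle_ineq)
    also have "\<dots> \<le> ip_norm ip (u m - u n) * ip_norm ip (v m) + ip_norm ip (u n) * ip_norm ip (v m - v n)"
      by (intro add_mono Cauchy_Schwarz diff_mem assms)
    also have "\<dots> \<le> ip_norm ip (u m - u n) * C + B * ip_norm ip (v m - v n)"
      by (intro add_mono mult_left_mono mult_right_mono B C ip_norm_nonneg diff_mem assms)
    also have "\<dots> < e / (2 * C) * C + B * (e / (2 * B))"
      using M[of m n] N[of m n] that B C
      by (intro add_strict_mono mult_strict_right_mono mult_strict_left_mono) auto
    also have "\<dots> = e"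
      using B C by simp
    finally show ?thesis
      by (simp add: dist_norm)
  qed
  then show "\<exists>M. \<forall>m\<ge>M. \<forall>n\<ge>M. dist (ip (u m) (v m)) (ip (u n) (v n)) < e"
    by blast
qed

end

text \<open>Norm convergence controls point values because they are inner products with \<open>K x\<close>.\<close>

locale reproducing_space = complex_inner_product_space V ip
  for V :: "('x \<Rightarrow> complex) set" and ip +
  fixes K :: "'x \<Rightarrow> 'x \<Rightarrow> complex"
  assumes V_eq: "V = range K"
    and reproducing: "u \<in> V \<Longrightarrow> ip u (K x) = u x"
begin

abbreviation "rep \<equiv> represents V ip"
abbreviation "cip \<equiv> completion_ip V ip"

lemma K_mem: "K x \<in> V"
  using V_eq by simp

lemma Cauchy_pointwise:
  assumes "\<And>n. u n \<in> V" "ip_Cauchy ip u"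
  shows "\<exists>h. rep u h"
proof -
  have "Cauchy (\<lambda>n. u n x)" for x
    using Cauchy_ip_Cauchy[OF assms K_mem[of x] ip_Cauchy_const[OF K_mem[of x]]]
      reproducing assms(1) by simp
  then have "\<forall>x. \<exists>l. (\<lambda>n. u n x) \<longlonglongrightarrow> l"
    using Cauchy_convergent convergent_def by blast
  then obtain h where "\<And>x. (\<lambda>n. u n x) \<longlonglongrightarrow> h x"
    by metis
  then show ?thesis
    using assms by (auto simp: represents_def)
qed

lemma rep_null:
  assumes "rep u 0"
  shows "(\<lambda>n. ip_norm ip (u n)) \<longlonglongrightarrow> 0"
proof -
  have u: "\<And>n. u n \<in> V" and C: "ip_Cauchy ip u" and pw: "\<And>x. (\<lambda>n. u n x) \<longlonglongrightarrow> 0"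
    using assms by (auto simp: represents_def)
  obtain B where B: "B > 0" "\<And>n. ip_norm ip (u n) \<le> B"
    using Cauchy_bounded[OF u C] by metis
  have "\<exists>N. \<forall>n\<ge>N. ip_norm ip (u n) < e" if "e > 0" for e
  proof -
    have "e\<^sup>2 / (2 * B) > 0"
      using that B by simp
    then obtain N where N: "\<And>m n. m \<ge> N \<Longrightarrow> n \<ge> N \<Longrightarrow> ip_norm ip (u m - u n) < e\<^sup>2 / (2 * B)"
      using C unfolding ip_Cauchy_def by meson
    have "ip_norm ip (u n) < e" if n: "n \<ge> N" for n
    proof -
      obtain x where x: "u n = K x"
        using u[of n] V_eq by auto
      have lim: "(\<lambda>m. cmod (ip (u m) (u n))) \<longlonglongrightarrow> 0"
        using tendsto_norm[OF pw[of x]] reproducing u x by simp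
      have bound: "(ip_norm ip (u n))\<^sup>2 - e\<^sup>2 / 2 \<le> cmod (ip (u m) (u n))" if m: "m \<ge> N" for m
      proof -
        have "(ip_norm ip (u n))\<^sup>2 = cmod (ip (u n) (u n))"
          using ip_self[OF u, of n] by (metis abs_power2 norm_of_real)
        also have "\<dots> = cmod (ip (u n - u m) (u n) + ip (u m) (u n))"
          using ip_diff u by simp
        also have "\<dots> \<le> ip_norm ip (u n - u m) * ip_norm ip (u n) + cmod (ip (u m) (u n))"
          using Cauchy_Schwarz[OF diff_mem[OF u u] u, of n m n]
          by (meson add_right_mono norm_triangle_ineq order_trans)
        also have "ip_norm ip (u n - u m) * ip_norm ip (u n) \<le> e\<^sup>2 / (2 * B) * B"
          using N[OF n m] B ip_norm_nonneg[OF u] ip_norm_nonneg[OF diff_mem[OF u u]]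
          by (intro mult_mono) auto
        also have "e\<^sup>2 / (2 * B) * B = e\<^sup>2 / 2"
          using B by simp
        finally show ?thesis by simp
      qed
      have "(ip_norm ip (u n))\<^sup>2 - e\<^sup>2 / 2 \<le> 0"
        by (rule tendsto_lowerbound[OF lim]) (auto simp: eventually_sequentially intro!: bound)
      then have "(ip_norm ip (u n))\<^sup>2 < e\<^sup>2"
        using \<open>e > 0\<close> by (smt (verit) field_sum_of_halves zero_less_power)
      then show ?thesis
        using \<open>e > 0\<close> by (simp add: power2_less_imp_less)
    qed
    then show ?thesis by blast
  qed
  then show ?thesis
    using ip_norm_nonneg[OF u] by (simp add: LIMSEQ_def)
qed

lemma rep_diff: "rep u h \<Longrightarrow> rep v k \<Longrightarrow> rep (\<lambda>n. u n - v n) (h - k)"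
  by (auto simp: represents_def diff_mem intro!: ip_Cauchy_diff tendsto_diff)

lemma rep_fscale:
  assumes "rep u h"
  shows "rep (\<lambda>n. fscale c (u n)) (fscale c h)"
proof -
  have "\<And>n. u n \<in> V" "ip_Cauchy ip u" "\<And>x. (\<lambda>n. u n x) \<longlonglongrightarrow> h x"
    using assms by (simp_all add: represents_def)
  then show ?thesis
    unfolding represents_def
    by (intro conjI allI fscale_mem ip_Cauchy_fscale) (auto simp: fscale_def intro: tendsto_mult_left)
qed

lemma rep_const: "u \<in> V \<Longrightarrow> rep (\<lambda>n. u) u"
  by (auto simp: represents_def ip_Cauchy_const)

lemma rep_add: "rep u h \<Longrightarrow> rep v k \<Longrightarrow> rep (\<lambda>n. u n + v n) (h + k)"
  using rep_diff[of u h "\<lambda>n. 0 - v n" "0 - k"] rep_diff[OF rep_const[OF zero_mem], of v k] by simp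

lemma tendsto_cip:
  assumes "rep u h" "rep v k"
  shows "(\<lambda>n. ip (u n) (v n)) \<longlonglongrightarrow> cip h k"
proof -
  have mem: "\<And>n. u n \<in> V" "\<And>n. v n \<in> V" and C: "ip_Cauchy ip u" "ip_Cauchy ip v"
    using assms by (auto simp: represents_def)
  obtain c where c: "(\<lambda>n. ip (u n) (v n)) \<longlonglongrightarrow> c"
    using Cauchy_convergent[OF Cauchy_ip_Cauchy[OF mem(1) C(1) mem(2) C(2)]]
    unfolding convergent_def by blast
  have other: "(\<lambda>n. ip (u' n) (v' n)) \<longlonglongrightarrow> c" if r: "rep u' h" "rep v' k" for u' v'
  proof -
    have mem': "\<And>n. u' n \<in> V" "\<And>n. v' n \<in> V" and C': "ip_Cauchy ip u'" "ip_Cauchy ip v'"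
      using r by (auto simp: represents_def)
    obtain B where B: "\<And>n. ip_norm ip (u n) \<le> B"
      using Cauchy_bounded[OF mem(1) C(1)] by metis
    obtain B' where B': "\<And>n. ip_norm ip (v' n) \<le> B'"
      using Cauchy_bounded[OF mem'(2) C'(2)] by metis
    have "(\<lambda>n. ip_norm ip (u' n - u n)) \<longlonglongrightarrow> 0" "(\<lambda>n. ip_norm ip (v' n - v n)) \<longlonglongrightarrow> 0"
      using rep_null[of "\<lambda>n. u' n - u n"] rep_null[of "\<lambda>n. v' n - v n"]
        rep_diff[OF r(1) assms(1)] rep_diff[OF r(2) assms(2)] by simp_all
    then have "(\<lambda>n. ip_norm ip (u' n - u n) * B' + B * ip_norm ip (v' n - v n)) \<longlonglongrightarrow> 0 * B' + B * 0"
      by (intro tendsto_intros)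
    then have lim: "(\<lambda>n. ip_norm ip (u' n - u n) * B' + B * ip_norm ip (v' n - v n)) \<longlonglongrightarrow> 0"
      by simp
    have "norm (ip (u' n) (v' n) - ip (u n) (v n))
        \<le> ip_norm ip (u' n - u n) * B' + B * ip_norm ip (v' n - v n)" for n
    proof -
      have "ip (u' n) (v' n) - ip (u n) (v n) = ip (u' n - u n) (v' n) + ip (u n) (v' n - v n)"
        using mem mem' by (simp add: ip_diff ip_diff_right)
      then have "norm (ip (u' n) (v' n) - ip (u n) (v n))
          \<le> cmod (ip (u' n - u n) (v' n)) + cmod (ip (u n) (v' n - v n))"
        by (metis norm_triangle_ineq)
      also have "\<dots> \<le> ip_norm ip (u' n - u n) * ip_norm ip (v' n)
          + ip_norm ip (u n) * ip_norm ip (v' n - v n)"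
        by (intro add_mono Cauchy_Schwarz diff_mem mem mem')
      also have "\<dots> \<le> ip_norm ip (u' n - u n) * B' + B * ip_norm ip (v' n - v n)"
        by (intro add_mono mult_left_mono mult_right_mono B B' ip_norm_nonneg diff_mem mem mem')
      finally show ?thesis .
    qed
    then have "(\<lambda>n. ip (u' n) (v' n) - ip (u n) (v n)) \<longlonglongrightarrow> 0"
      by (intro Lim_null_comparison[OF _ lim] always_eventually allI)
    from tendsto_add[OF this c] show ?thesis
      by simp
  qed
  have "cip h k = c"
    unfolding completion_ip_def
  proof (rule the_equality)
    show "\<forall>u v. rep u h \<longrightarrow> rep v k \<longrightarrow> (\<lambda>n. ip (u n) (v n)) \<longlonglongrightarrow> c"
      using other by blast
    show "c' = c" if "\<forall>u v. rep u h \<longrightarrow> rep v k \<longrightarrow> (\<lambda>n. ip (u n) (v n)) \<longlonglongrightarrow> c'" for c'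
      by (rule LIMSEQ_unique[OF _ c]) (use that assms in simp)
  qed
  then show ?thesis
    using c by simp
qed

lemma cip_eqI: "rep u h \<Longrightarrow> rep v k \<Longrightarrow> (\<lambda>n. ip (u n) (v n)) \<longlonglongrightarrow> c \<Longrightarrow> cip h k = c"
  by (rule LIMSEQ_unique[OF tendsto_cip])

lemma tendsto_norm_cip:
  assumes "rep u h"
  shows "(\<lambda>n. ip_norm ip (u n)) \<longlonglongrightarrow> ip_norm cip h"
  unfolding ip_norm_def by (intro tendsto_real_sqrt tendsto_Re tendsto_cip assms)

lemma V_subset_completion: "V \<subseteq> fn_completion V ip"
  using rep_const by (auto simp: fn_completion_def)

lemma cip_extends: "u \<in> V \<Longrightarrow> v \<in> V \<Longrightarrow> cip u v = ip u v"
  using cip_eqI[OF rep_const rep_const] by simp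

lemma completion_inner_product_space: "complex_inner_product_space (fn_completion V ip) cip"
proof
  show "0 \<in> fn_completion V ip"
    using zero_mem V_subset_completion by blast
next
  fix h k assume "h \<in> fn_completion V ip" "k \<in> fn_completion V ip"
  then show "h + k \<in> fn_completion V ip"
    using rep_add by (fastforce simp: fn_completion_def)
next
  fix h c assume "h \<in> fn_completion V ip"
  then show "fscale c h \<in> fn_completion V ip"
    using rep_fscale by (fastforce simp: fn_completion_def)
next
  fix h k l assume "h \<in> fn_completion V ip" "k \<in> fn_completion V ip" "l \<in> fn_completion V ip"
  then obtain u v w where r: "rep u h" "rep v k" "rep w l"
    by (auto simp: fn_completion_def)
  have "ip (u n + v n) (w n) = ip (u n) (w n) + ip (v n) (w n)" for n
    using r ip_add by (simp add: represents_def)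
  then show "cip (h + k) l = cip h l + cip k l"
    using cip_eqI[OF rep_add[OF r(1,2)] r(3)] tendsto_add[OF tendsto_cip tendsto_cip] r by simp
next
  fix h l c assume "h \<in> fn_completion V ip" "l \<in> fn_completion V ip"
  then obtain u w where r: "rep u h" "rep w l"
    by (auto simp: fn_completion_def)
  have "ip (fscale c (u n)) (w n) = c * ip (u n) (w n)" for n
    using r ip_fscale by (simp add: represents_def)
  then show "cip (fscale c h) l = c * cip h l"
    using cip_eqI[OF rep_fscale[OF r(1)] r(2)] tendsto_mult_left[OF tendsto_cip] r by simp
next
  fix h l assume "h \<in> fn_completion V ip" "l \<in> fn_completion V ip"
  then obtain u w where r: "rep u h" "rep w l"
    by (auto simp: fn_completion_def)
  have "(\<lambda>n. ip (w n) (u n)) = (\<lambda>n. cnj (ip (u n) (w n)))"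
    using r by (intro ext ip_cnj) (simp_all add: represents_def)
  then show "cip l h = cnj (cip h l)"
    using cip_eqI[OF r(2,1)] tendsto_cnj[OF tendsto_cip] r by simp
next
  fix h assume "h \<in> fn_completion V ip"
  then obtain u where r: "rep u h"
    by (auto simp: fn_completion_def)
  show "0 \<le> Re (cip h h)"
    by (rule tendsto_lowerbound[OF tendsto_Re[OF tendsto_cip[OF r r]]])
      (use r ip_nonneg in \<open>auto simp: represents_def\<close>)
next
  fix h assume "h \<in> fn_completion V ip" and 0: "cip h h = 0"
  then obtain u where r: "rep u h"
    by (auto simp: fn_completion_def)
  have lim: "(\<lambda>n. ip_norm ip (u n)) \<longlonglongrightarrow> 0"
    using tendsto_norm_cip[OF r] 0 by (simp add: ip_norm_def)
  have "h x = 0" for x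
  proof -
    have l: "(\<lambda>n. ip_norm ip (u n) * ip_norm ip (K x)) \<longlonglongrightarrow> 0"
      using tendsto_mult_right[OF lim, of "ip_norm ip (K x)"] by simp
    have "norm (u n x) \<le> ip_norm ip (u n) * ip_norm ip (K x)" for n
      using Cauchy_Schwarz[of "u n" "K x"] K_mem reproducing[of "u n" x] r
      by (simp add: represents_def)
    then have "(\<lambda>n. u n x) \<longlonglongrightarrow> 0"
      by (intro Lim_null_comparison[OF _ l]) (auto intro: always_eventually)
    moreover have "(\<lambda>n. u n x) \<longlonglongrightarrow> h x"
      using r by (simp add: represents_def)
    ultimately show ?thesis
      by (metis LIMSEQ_unique)
  qed
  then show "h = 0"
    by (simp add: fun_eq_iff)
qed

sublocale C: complex_inner_product_space "fn_completion V ip" cip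
  by (rule completion_inner_product_space)

lemma rep_tendsto:
  assumes r: "rep u h"
  shows "ip_tendsto cip u h"
  unfolding ip_tendsto_def
proof (rule LIMSEQ_I)
  fix e :: real
  assume e: "e > 0"
  have u: "\<And>n. u n \<in> V" and C: "ip_Cauchy ip u"
    using r by (simp_all add: represents_def)
  have h: "h \<in> fn_completion V ip"
    unfolding fn_completion_def using r by blast
  have "e / 2 > 0"
    using e by simp
  then obtain N where N: "\<And>m n. m \<ge> N \<Longrightarrow> n \<ge> N \<Longrightarrow> ip_norm ip (u m - u n) < e / 2"
    using C unfolding ip_Cauchy_def by meson
  have "norm (ip_norm cip (u n - h) - 0) < e" if n: "n \<ge> N" for n
  proof -
    have un: "u n \<in> fn_completion V ip"
      using V_subset_completion u by (rule subsetD)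
    have lim: "(\<lambda>m. ip_norm ip (u n - u m)) \<longlonglongrightarrow> ip_norm cip (u n - h)"
      by (rule tendsto_norm_cip[OF rep_diff[OF rep_const[OF u] r]])
    have "ip_norm cip (u n - h) \<le> e / 2"
      by (rule LIMSEQ_le_const2[OF lim]) (intro exI[of _ N] allI impI, rule less_imp_le, rule N[OF n])
    then show ?thesis
      using C.ip_norm_nonneg[OF C.diff_mem[OF un h]] e by simp
  qed
  then show "\<exists>N. \<forall>n\<ge>N. norm (ip_norm cip (u n - h) - 0) < e"
    by (intro exI[of _ N] allI impI)
qed

lemma completion_complete:
  assumes h: "\<And>n. h n \<in> fn_completion V ip" and C: "ip_Cauchy cip h"
  shows "\<exists>k\<in>fn_completion V ip. ip_tendsto cip h k"
proof -
  have "\<exists>v\<in>V. ip_norm cip (h n - v) < 1 / Suc n" for n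
  proof -
    obtain u where r: "rep u (h n)"
      using h[of n] by (auto simp: fn_completion_def)
    then have u: "\<And>m. u m \<in> V"
      by (simp add: represents_def)
    have "(\<lambda>m. ip_norm cip (u m - h n)) \<longlonglongrightarrow> 0"
      using rep_tendsto[OF r] by (simp add: ip_tendsto_def)
    then have "\<exists>N. \<forall>m\<ge>N. \<bar>ip_norm cip (u m - h n)\<bar> < 1 / Suc n"
      unfolding LIMSEQ_def dist_real_def
      by (metis diff_zero of_nat_0_less_iff zero_less_Suc zero_less_divide_1_iff)
    then obtain m where "ip_norm cip (u m - h n) < 1 / Suc n"
      by (meson abs_less_iff order_refl)
    then show ?thesis
      using C.ip_norm_minus_commute[OF h, of "u m" n] u[of m] V_subset_completion
      by (metis in_mono)
  qed
  then obtain v where v: "\<And>n. v n \<in> V" and hv: "\<And>n. ip_norm cip (h n - v n) < 1 / Suc n"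
    by metis
  have v': "v n \<in> fn_completion V ip" for n
    using v V_subset_completion by blast
  have nn: "0 \<le> ip_norm cip (h n - v n)" for n
    using C.ip_norm_nonneg C.diff_mem h v' by blast
  have inv: "(\<lambda>n. 1 / real (Suc n)) \<longlonglongrightarrow> 0"
    using LIMSEQ_inverse_real_of_nat by (simp add: inverse_eq_divide)
  have lim: "(\<lambda>n. ip_norm cip (h n - v n)) \<longlonglongrightarrow> 0"
    by (rule Lim_null_comparison[OF _ inv])
      (use hv nn in \<open>auto intro!: always_eventually less_imp_le\<close>)
  have "ip_Cauchy ip v"
    unfolding ip_Cauchy_def
  proof (intro allI impI)
    fix e :: real
    assume "e > 0"
    then have e3: "e / 3 > 0" by simp
    obtain M where M: "\<And>m n. m \<ge> M \<Longrightarrow> n \<ge> M \<Longrightarrow> ip_norm cip (h m - h n) < e / 3"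
      using C e3 unfolding ip_Cauchy_def by meson
    obtain N where N: "\<And>n. n \<ge> N \<Longrightarrow> ip_norm cip (h n - v n) < e / 3"
      using LIMSEQ_D[OF lim e3] nn by auto
    have "ip_norm ip (v m - v n) < e" if "m \<ge> max M N" "n \<ge> max M N" for m n
    proof -
      have "ip_norm ip (v m - v n) = ip_norm cip (v m - v n)"
        using cip_extends diff_mem v by (simp add: ip_norm_def)
      also have "\<dots> \<le> ip_norm cip (v m - h m) + ip_norm cip (h m - v n)"
        using C.ip_norm_diff_triangle v' h by blast
      also have "ip_norm cip (h m - v n) \<le> ip_norm cip (h m - h n) + ip_norm cip (h n - v n)"
        using C.ip_norm_diff_triangle v' h by blast
      finally show ?thesis
        using M[of m n] N[of m] N[of n] that C.ip_norm_minus_commute[OF h[of m] v'[of m]] by linarith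
    qed
    then show "\<exists>N. \<forall>m\<ge>N. \<forall>n\<ge>N. ip_norm ip (v m - v n) < e"
      by blast
  qed
  then obtain k where r: "rep v k"
    using Cauchy_pointwise v by blast
  then have k: "k \<in> fn_completion V ip"
    by (auto simp: fn_completion_def)
  have l: "(\<lambda>n. ip_norm cip (h n - v n) + ip_norm cip (v n - k)) \<longlonglongrightarrow> 0"
    using tendsto_add[OF lim] rep_tendsto[OF r] by (fastforce simp: ip_tendsto_def)
  have "norm (ip_norm cip (h n - k)) \<le> ip_norm cip (h n - v n) + ip_norm cip (v n - k)" for n
    using C.ip_norm_diff_triangle[OF h v' k, of n n] C.ip_norm_nonneg[OF C.diff_mem[OF h k], of n]
    by simp
  then have "ip_tendsto cip h k"
    unfolding ip_tendsto_def
    by (intro Lim_null_comparison[OF _ l]) (auto intro: always_eventually)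
  then show ?thesis
    using k by blast
qed

theorem completion_correct: "hilbert_completion V ip (fn_completion V ip) cip"
proof
  show "V \<subseteq> fn_completion V ip"
    by (rule V_subset_completion)
next
  fix h assume "h \<in> fn_completion V ip"
  then obtain u where "rep u h"
    by (auto simp: fn_completion_def)
  then show "\<exists>u. (\<forall>n::nat. u n \<in> V) \<and> ip_tendsto cip u h"
    using rep_tendsto by (auto simp: represents_def)
next
  show "\<exists>k\<in>fn_completion V ip. ip_tendsto cip h k"
    if "\<And>n. h n \<in> fn_completion V ip" "ip_Cauchy cip h" for h
    by (rule completion_complete) (use that in auto)
next
  show "cip u v = ip u v" if "u \<in> V" "v \<in> V" for u v
    using cip_extends that by simp
qed

end

context
  fixes f :: "'a::complex_star_algebra \<Rightarrow> complex"
  assumes f: "positive_functional f"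
begin

lemma f_add: "f (a + b) = f a + f b"
  using f by (simp add: positive_functional_def complex_linear_def)

lemma f_scaleC: "f (c *\<^sub>C a) = c * f a"
  using f by (simp add: positive_functional_def complex_linear_def)

lemma f_pos: "Im (f (a\<^sup>\<star> * a)) = 0" "0 \<le> Re (f (a\<^sup>\<star> * a))"
  using f by (auto simp: positive_functional_def complex_nonneg_Reals_iff)

lemma f_expand:
  "f ((a + c *\<^sub>C b)\<^sup>\<star> * (a + c *\<^sub>C b)) =
     f (a\<^sup>\<star> * a) + c * f (a\<^sup>\<star> * b) + cnj c * f (b\<^sup>\<star> * a) + cnj c * c * f (b\<^sup>\<star> * b)"
  by (simp add: star_add star_scaleC distrib_left distrib_right f_add f_scaleC
      mult_scaleC_left mult_scaleC_right scaleC_scaleC)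

lemma f_cnj: "f (a\<^sup>\<star> * b) = cnj (f (b\<^sup>\<star> * a))"
proof -
  have "Im (f (a\<^sup>\<star> * b)) + Im (f (b\<^sup>\<star> * a)) = 0"
    using f_pos(1)[of "a + 1 *\<^sub>C b"] f_pos(1)[of a] f_pos(1)[of b] f_expand[of a 1 b] by simp
  moreover have "Re (f (a\<^sup>\<star> * b)) - Re (f (b\<^sup>\<star> * a)) = 0"
    using f_pos(1)[of "a + \<i> *\<^sub>C b"] f_pos(1)[of a] f_pos(1)[of b] f_expand[of a \<i> b] by simp
  ultimately show ?thesis
    by (simp add: complex_eq_iff)
qed

lemma f_null:
  assumes "f (a\<^sup>\<star> * a) = 0"
  shows "f (x\<^sup>\<star> * a) = 0"
proof (rule ccontr)
  let ?z = "f (x\<^sup>\<star> * a)"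
  assume "?z \<noteq> 0"
  then have z: "(cmod ?z)\<^sup>2 > 0"
    by simp
  have pos: "0 \<le> Re (f (x\<^sup>\<star> * x)) - 2 * t * (cmod ?z)\<^sup>2" for t :: real
  proof -
    let ?c = "- of_real t * cnj ?z"
    have "f ((x + ?c *\<^sub>C a)\<^sup>\<star> * (x + ?c *\<^sub>C a)) = f (x\<^sup>\<star> * x) + ?c * ?z + cnj ?c * cnj ?z"
      using f_expand[of x ?c a] f_cnj[of a x] assms by simp
    also have "\<dots> = f (x\<^sup>\<star> * x) - of_real (2 * t * (cmod ?z)\<^sup>2)"
      using complex_norm_square[of ?z] by (simp add: algebra_simps)
    finally show ?thesis
      using f_pos(2)[of "x + ?c *\<^sub>C a"] by simp
  qed
  have "2 * ((Re (f (x\<^sup>\<star> * x)) + 1) / (2 * (cmod ?z)\<^sup>2)) * (cmod ?z)\<^sup>2 = Re (f (x\<^sup>\<star> * x)) + 1"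
    using z by simp
  then show False
    using pos[of "(Re (f (x\<^sup>\<star> * x)) + 1) / (2 * (cmod ?z)\<^sup>2)"] by linarith
qed

lemma assoc_op_add: "assoc_op f (a + b) = assoc_op f a + assoc_op f b"
  by (simp add: assoc_op_def fun_eq_iff distrib_left f_add)

lemma assoc_op_scaleC: "assoc_op f (c *\<^sub>C a) = fscale c (assoc_op f a)"
  by (simp add: assoc_op_def fscale_def mult_scaleC_right f_scaleC)

lemma ran_ip_assoc_op: "ran_ip f (assoc_op f a) (assoc_op f b) = f (b\<^sup>\<star> * a)"
  unfolding ran_ip_def
proof (rule the_equality)
  fix c
  assume "\<exists>a' b'. assoc_op f a = assoc_op f a' \<and> assoc_op f b = assoc_op f b' \<and> c = f (b'\<^sup>\<star> * a')"
  then obtain a' b' where *: "assoc_op f a = assoc_op f a'" "assoc_op f b = assoc_op f b'"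
    "c = f (b'\<^sup>\<star> * a')"
    by blast
  have A: "f (x\<^sup>\<star> * a) = f (x\<^sup>\<star> * a')" and B: "f (x\<^sup>\<star> * b) = f (x\<^sup>\<star> * b')" for x
    using fun_cong[OF *(1), of x] fun_cong[OF *(2), of x] by (simp_all add: assoc_op_def)
  show "c = f (b\<^sup>\<star> * a)"
    using *(3) A[of b'] B[of a] f_cnj by metis
qed blast

lemma reproducing_space_ran: "reproducing_space (range (assoc_op f)) (ran_ip f) (assoc_op f)"
proof
  have "assoc_op f 0 = 0"
    using assoc_op_add[of 0 0] by simp
  then show "0 \<in> range (assoc_op f)"
    by (metis rangeI)
next
  fix u assume "u \<in> range (assoc_op f)" and 0: "ran_ip f u u = 0"
  then obtain a where a: "u = assoc_op f a"
    by blast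
  show "u = 0"
    using 0 f_null by (auto simp: a ran_ip_assoc_op) (simp add: assoc_op_def fun_eq_iff)
next
  fix u x assume "u \<in> range (assoc_op f)"
  then show "ran_ip f u (assoc_op f x) = u x"
    by (auto simp: ran_ip_assoc_op) (simp add: assoc_op_def)
next
  fix u w assume "u \<in> range (assoc_op f)" "w \<in> range (assoc_op f)"
  then obtain a b where "u = assoc_op f a" "w = assoc_op f b"
    by blast
  then show "ran_ip f w u = cnj (ran_ip f u w)"
    using f_cnj[of a b] by (simp add: ran_ip_assoc_op)
next
  fix u v assume "u \<in> range (assoc_op f)" "v \<in> range (assoc_op f)"
  then show "u + v \<in> range (assoc_op f)"
    by (auto simp: assoc_op_add[symmetric])
next
  fix u c assume "u \<in> range (assoc_op f)"
  then show "fscale c u \<in> range (assoc_op f)"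
    by (auto simp: assoc_op_scaleC[symmetric])
next
  fix u v w assume "u \<in> range (assoc_op f)" "v \<in> range (assoc_op f)" "w \<in> range (assoc_op f)"
  then obtain a b c where "u = assoc_op f a" "v = assoc_op f b" "w = assoc_op f c"
    by blast
  then show "ran_ip f (u + v) w = ran_ip f u w + ran_ip f v w"
    by (simp add: assoc_op_add[symmetric] ran_ip_assoc_op distrib_left f_add)
next
  fix u w c assume "u \<in> range (assoc_op f)" "w \<in> range (assoc_op f)"
  then obtain a b where "u = assoc_op f a" "w = assoc_op f b"
    by blast
  then show "ran_ip f (fscale c u) w = c * ran_ip f u w"
    by (simp add: assoc_op_scaleC[symmetric] ran_ip_assoc_op mult_scaleC_right f_scaleC)
next
  fix u assume "u \<in> range (assoc_op f)"
  then show "0 \<le> Re (ran_ip f u u)"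
    by (auto simp: ran_ip_assoc_op f_pos)
qed simp

theorem gns_space_completion:
  "hilbert_completion (range (assoc_op f)) (ran_ip f) (gns_space f) (gns_ip f)"
  unfolding gns_space_def gns_ip_def
  by (rule reproducing_space.completion_correct[OF reproducing_space_ran])

end

end

theory Submission
  imports Defs
begin

text \<open>
  Write \<open>A\<close> and \<open>B\<close> for \<open>assoc_op f\<close> and \<open>assoc_op g\<close>, and \<open>G\<close> for the closure of
  \<open>{(A a, B a) | a}\<close> in the product of the two GNS spaces. This is a closed linear relation; its
  part over \<open>0\<close> is \<open>\<MM>\<close> (\<open>(0, \<zeta>) \<in> G\<close> iff \<open>\<zeta> \<in> \<MM>\<close>) and its kernel is \<open>\<NN>\<close>
  (\<open>(\<xi>, 0) \<in> G\<close> iff \<open>\<xi> \<in> \<NN>\<close>). Let \<open>Q\<close> and \<open>P\<close> be the orthogonal projections onto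
  \<open>\<MM>\<close> and \<open>\<NN>\<close>. As \<open>\<NN> \<times> \<MM>\<close> is contained in \<open>G\<close>, subtracting \<open>(P A a, 0)\<close> and \<open>(0, Q B a)\<close> from
  \<open>(A a, B a)\<close> gives \<open>((I - P) A a, (I - Q) B a) \<in> G\<close>.

  The subspace \<open>\<MM>\<close> is invariant under the GNS representation, so \<open>Q\<close> commutes with it, and
  therefore \<open>g\<^sub>a (a\<^sup>\<star> a) = \<parallel>(I - Q) B a\<parallel>\<^sup>2\<close> (lemma \<open>ac_part_self\<close>); likewise
  \<open>f\<^sub>a (a\<^sup>\<star> a) = \<parallel>(I - P) A a\<parallel>\<^sup>2\<close>. Now suppose \<open>f\<^sub>a (a\<^sub>n\<^sup>\<star> a\<^sub>n) \<rightarrow> 0\<close> and \<open>(a\<^sub>n)\<close> is Cauchy for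
  \<open>g\<^sub>a\<close>. Then \<open>(I - P) A a\<^sub>n \<rightarrow> 0\<close> and \<open>(I - Q) B a\<^sub>n\<close> has a limit \<open>\<eta>\<close>. Since \<open>G\<close> is closed,
  \<open>(0, \<eta>) \<in> G\<close>, that is \<open>\<eta> \<in> \<MM>\<close>; but \<open>\<eta>\<close> is also orthogonal to \<open>\<MM>\<close>, so \<open>\<eta> = 0\<close>. This is
  \<open>g\<^sub>a \<lless> f\<^sub>a\<close> (lemma \<open>ac_part_absolutely_continuous\<close>), and the other half follows by exchanging the
  functionals.

  The objects of the GNS construction are given by definite descriptions, so their existence is
  part of the proof. Projections and the cyclic vector come from one Riesz theorem
  (\<open>riesz_on_subspace\<close>). Because the completion consists of functions on the algebra, the rest is
  explicit: the representation acts by translating the argument, and the cyclic vector is the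
  complex conjugate of the functional (\<open>gns_rep_eq\<close>, \<open>gns_vector_eq\<close>).
\<close>

section \<open>Riesz representation and orthogonal projections\<close>

context complex_inner_product_space
begin

lemma ip_norm_square: "u \<in> V \<Longrightarrow> (ip_norm ip u)\<^sup>2 = Re (ip u u)"
  by (simp add: ip_norm_def ip_nonneg)

lemma ip_norm_square_add:
  assumes "u \<in> V" "v \<in> V"
  shows "(ip_norm ip (u + v))\<^sup>2 = (ip_norm ip u)\<^sup>2 + 2 * Re (ip u v) + (ip_norm ip v)\<^sup>2"
  using assms ip_cnj[of u v] add_mem[OF assms]
  by (simp add: ip_norm_square ip_add ip_add_right)

lemma ip_norm_square_diff:
  assumes "u \<in> V" "v \<in> V"
  shows "(ip_norm ip (u - v))\<^sup>2 = (ip_norm ip u)\<^sup>2 - 2 * Re (ip u v) + (ip_norm ip v)\<^sup>2"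
  using assms ip_cnj[of u v] diff_mem[OF assms]
  by (simp add: ip_norm_square ip_diff ip_diff_right)

lemma ip_norm_diff_le:
  assumes "u \<in> V" "v \<in> V"
  shows "ip_norm ip (u - v) \<le> ip_norm ip u + ip_norm ip v"
  using ip_norm_triangle[OF assms(1) uminus_mem[OF assms(2)]] ip_norm_fscale[OF assms(2), of "- 1"]
  by (simp add: fscale_minus_one)

lemma tendsto_ip_left:
  assumes u: "\<And>n. u n \<in> V" and z: "z \<in> V" and w: "w \<in> V" and lim: "ip_tendsto ip u z"
  shows "(\<lambda>n. ip (u n) w) \<longlonglongrightarrow> ip z w"
proof -
  have *: "(\<lambda>n. ip_norm ip (u n - z) * ip_norm ip w) \<longlonglongrightarrow> 0"
    using lim tendsto_mult_left_zero unfolding ip_tendsto_def by blast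
  have "norm (ip (u n) w - ip z w) \<le> ip_norm ip (u n - z) * ip_norm ip w" for n
    using Cauchy_Schwarz[OF diff_mem[OF u z] w, of n] ip_diff[OF u z w, of n] by simp
  then have "(\<lambda>n. ip (u n) w - ip z w) \<longlonglongrightarrow> 0"
    by (intro Lim_null_comparison[OF _ *] always_eventually allI)
  then show ?thesis
    by (simp add: LIM_zero_iff)
qed

lemma ip_tendsto_unique:
  assumes u: "\<And>n. u n \<in> V" and "v \<in> V" "w \<in> V"
    and "ip_tendsto ip u v" "ip_tendsto ip u w"
  shows "v = w"
proof -
  have "ip v (v - w) = ip w (v - w)"
    using LIMSEQ_unique[OF tendsto_ip_left tendsto_ip_left] assms diff_mem by blast
  then have "ip (v - w) (v - w) = 0"
    using assms diff_mem ip_diff by simp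
  then have "v - w = 0"
    using assms diff_mem ip_definite by blast
  then show ?thesis
    by simp
qed

lemma inner_product_subspace:
  assumes "W \<subseteq> V" "0 \<in> W" "\<And>u v. u \<in> W \<Longrightarrow> v \<in> W \<Longrightarrow> u + v \<in> W"
    "\<And>c u. u \<in> W \<Longrightarrow> fscale c u \<in> W"
  shows "complex_inner_product_space W ip"
proof
  show "u \<in> W \<Longrightarrow> w \<in> W \<Longrightarrow> ip w u = cnj (ip u w)" for u w
    using assms(1) by (intro ip_cnj) auto
  show "u \<in> W \<Longrightarrow> ip u u = 0 \<Longrightarrow> u = 0" for u
    using assms(1) by (intro ip_definite) auto
qed (use assms in \<open>auto intro: ip_add ip_fscale ip_nonneg\<close>)

end

text \<open>The first-order condition at a minimum: for small \<open>t\<close> of the right sign the linear term would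
  be negative and outweigh the quadratic one.\<close>

lemma linear_term_zero:
  fixes c q :: real
  assumes q: "q \<ge> 0" and nonneg: "\<And>t. 0 \<le> 2 * t * c + t\<^sup>2 * q"
  shows "c = 0"
proof (rule ccontr)
  assume c: "c \<noteq> 0"
  have "2 * (- c / (q + 1)) * c + (- c / (q + 1))\<^sup>2 * q = - (c\<^sup>2 * (q + 2)) / (q + 1)\<^sup>2"
    using q by (simp add: field_simps power2_eq_square add_nonneg_eq_0_iff)
  moreover have "c\<^sup>2 * (q + 2) / (q + 1)\<^sup>2 > 0"
    using q c by (intro divide_pos_pos mult_pos_pos) auto
  ultimately show False
    using nonneg[of "- c / (q + 1)"] by simp
qed

text \<open>The representing vector is the limit of a minimising sequence of the functional
  \<open>w \<mapsto> \<parallel>w\<parallel>\<^sup>2 - 2 Re (L w)\<close>. The subspace is kept apart from the Hilbert space because two cases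
  are wanted: a dense subspace gives the cyclic vector; a closed one gives the orthogonal
  projection, and there the approximating sequence shows that the limit stays in the subspace.\<close>

lemma (in complex_hilbert_space) riesz_on_subspace:
  assumes W: "complex_inner_product_space W ip" and WV: "W \<subseteq> V"
    and add: "\<And>u v. u \<in> W \<Longrightarrow> v \<in> W \<Longrightarrow> L (u + v) = L u + L v"
    and scale: "\<And>c u. u \<in> W \<Longrightarrow> L (fscale c u) = c * L u"
    and bound: "\<And>u. u \<in> W \<Longrightarrow> cmod (L u) \<le> K * ip_norm ip u"
  obtains u z where "\<And>n::nat. u n \<in> W" "z \<in> V" "ip_tendsto ip u z" "\<And>w. w \<in> W \<Longrightarrow> L w = ip w z"
proof -
  interpret W: complex_inner_product_space W ip
    by (rule W)
  define J where "J w = (ip_norm ip w)\<^sup>2 - 2 * Re (L w)" for w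
  have "- K\<^sup>2 \<le> J w" if "w \<in> W" for w
  proof -
    have "0 \<le> (ip_norm ip w - K)\<^sup>2"
      by simp
    then show ?thesis
      using bound[OF that] complex_Re_le_cmod[of "L w"]
      by (simp add: J_def power2_diff algebra_simps)
  qed
  then have bdd: "bdd_below (J ` W)"
    by (auto intro!: bdd_belowI2)
  define m where "m = Inf (J ` W)"
  have m: "m \<le> J w" if "w \<in> W" for w
    unfolding m_def using bdd that by (auto intro!: cInf_lower)
  have "\<exists>w\<in>W. J w < m + 1 / Suc n" for n
  proof -
    have "Inf (J ` W) < m + 1 / Suc n"
      by (simp add: m_def)
    moreover have "J ` W \<noteq> {}"
      using W.zero_mem by blast
    ultimately obtain y where "y \<in> J ` W" "y < m + 1 / Suc n"
      by (metis cInf_lessD)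
    then show ?thesis
      by blast
  qed
  then obtain u where u: "\<And>n. u n \<in> W" and Ju: "\<And>n. J (u n) < m + 1 / Suc n"
    by metis
  have inv: "(\<lambda>n. 1 / real (Suc n)) \<longlonglongrightarrow> 0"
    using LIMSEQ_inverse_real_of_nat by (simp add: inverse_eq_divide)
  \<comment> \<open>The parallelogram law compares both vectors with their midpoint.\<close>
  have close: "(ip_norm ip (u i - u j))\<^sup>2 \<le> 2 / Suc i + 2 / Suc j" for i j
  proof -
    let ?h = "fscale (1 / 2) (u i + u j)"
    have h: "?h \<in> W"
      using u W.add_mem W.fscale_mem by blast
    have "J ?h = (ip_norm ip (u i + u j))\<^sup>2 / 4 - (Re (L (u i)) + Re (L (u j)))"
      using u W.add_mem add scale
      by (simp add: J_def W.ip_norm_fscale power_mult_distrib power_divide add_divide_distrib)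
    moreover have "(ip_norm ip (u i - u j))\<^sup>2
        = 2 * (ip_norm ip (u i))\<^sup>2 + 2 * (ip_norm ip (u j))\<^sup>2 - (ip_norm ip (u i + u j))\<^sup>2"
      using W.ip_norm_square_add[OF u u, of i j] W.ip_norm_square_diff[OF u u, of i j] by simp
    ultimately have "(ip_norm ip (u i - u j))\<^sup>2 = 2 * J (u i) + 2 * J (u j) - 4 * J ?h"
      by (simp add: J_def)
    then show ?thesis
      using m[OF h] Ju[of i] Ju[of j] by (simp add: algebra_simps)
  qed
  have "ip_Cauchy ip u"
    unfolding ip_Cauchy_def
  proof (intro allI impI)
    fix e :: real
    assume e: "e > 0"
    then have "e\<^sup>2 / 4 > 0"
      by simp
    from LIMSEQ_D[OF inv this] obtain N
      where N: "\<And>n. n \<ge> N \<Longrightarrow> 1 / real (Suc n) < e\<^sup>2 / 4"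
      by auto
    have "ip_norm ip (u i - u j) < e" if "i \<ge> N" "j \<ge> N" for i j
    proof -
      have "(ip_norm ip (u i - u j))\<^sup>2 < e\<^sup>2"
        using close[of i j] N[OF that(1)] N[OF that(2)] by simp
      then show ?thesis
        using e by (simp add: power2_less_imp_less)
    qed
    then show "\<exists>N. \<forall>i\<ge>N. \<forall>j\<ge>N. ip_norm ip (u i - u j) < e"
      by blast
  qed
  then obtain z where z: "z \<in> V" and lim: "ip_tendsto ip u z"
    using complete[of u] u WV by blast
  \<comment> \<open>Moving the minimising sequence in the direction \<open>w\<close> cannot bring \<open>J\<close> below \<open>m\<close>.\<close>
  have re: "Re (ip z w) = Re (L w)" if w: "w \<in> W" for w
  proof -
    have "0 \<le> 2 * t * (Re (ip z w) - Re (L w)) + t\<^sup>2 * (ip_norm ip w)\<^sup>2" for t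
    proof -
      let ?tw = "fscale (of_real t) w"
      have tw: "?tw \<in> W"
        using w W.fscale_mem by blast
      have "0 \<le> 2 * t * (Re (ip (u n) w) - Re (L w)) + t\<^sup>2 * (ip_norm ip w)\<^sup>2 + 1 / Suc n" for n
      proof -
        have "J (u n + ?tw) = J (u n) + 2 * t * (Re (ip (u n) w) - Re (L w)) + t\<^sup>2 * (ip_norm ip w)\<^sup>2"
          using W.ip_norm_square_add[OF u tw, of n] u[of n] w tw
          by (simp add: J_def add scale W.ip_fscale_right W.ip_norm_fscale power_mult_distrib
              algebra_simps)
        then show ?thesis
          using m[OF W.add_mem[OF u tw], of n] Ju[of n] by simp
      qed
      moreover have "(\<lambda>n. 2 * t * (Re (ip (u n) w) - Re (L w)) + t\<^sup>2 * (ip_norm ip w)\<^sup>2 + 1 / Suc n)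
          \<longlonglongrightarrow> 2 * t * (Re (ip z w) - Re (L w)) + t\<^sup>2 * (ip_norm ip w)\<^sup>2 + 0"
        by (intro tendsto_intros inv tendsto_ip_left z lim) (use u w WV in auto)
      ultimately have "0 \<le> 2 * t * (Re (ip z w) - Re (L w)) + t\<^sup>2 * (ip_norm ip w)\<^sup>2 + 0"
        by (intro tendsto_lowerbound[where F = sequentially]) (auto intro: always_eventually)
      then show ?thesis
        by simp
    qed
    then show ?thesis
      using linear_term_zero[of "(ip_norm ip w)\<^sup>2"] by fastforce
  qed
  have "L w = ip w z" if w: "w \<in> W" for w
  proof -
    \<comment> \<open>The direction \<open>\<i> w\<close> yields the imaginary part.\<close>
    have "Im (ip z w) = - Im (L w)"
      using re[OF W.fscale_mem[OF w, of \<i>]] w WV z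
      by (auto simp: ip_fscale_right scale subset_iff)
    then show ?thesis
      using re[OF w] ip_cnj[OF z, of w] w WV by (auto simp: complex_eq_iff subset_iff)
  qed
  then show ?thesis
    using that u z lim by blast
qed

locale closed_subspace = complex_hilbert_space V ip
  for V :: "('x \<Rightarrow> complex) set" and ip +
  fixes W :: "('x \<Rightarrow> complex) set"
  assumes W_subset: "W \<subseteq> V"
    and W_zero: "0 \<in> W"
    and W_add: "u \<in> W \<Longrightarrow> v \<in> W \<Longrightarrow> u + v \<in> W"
    and W_fscale: "u \<in> W \<Longrightarrow> fscale c u \<in> W"
    and W_closed: "(\<And>n::nat. s n \<in> W) \<Longrightarrow> z \<in> V \<Longrightarrow> ip_tendsto ip s z \<Longrightarrow> z \<in> W"
begin

abbreviation "proj \<equiv> orth_projection ip W"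

lemma W_inner_product_space: "complex_inner_product_space W ip"
  by (rule inner_product_subspace[OF W_subset W_zero W_add W_fscale])

lemma W_diff: "u \<in> W \<Longrightarrow> v \<in> W \<Longrightarrow> u - v \<in> W"
  by (rule complex_inner_product_space.diff_mem[OF W_inner_product_space])

lemma proj_eqI:
  assumes h: "h \<in> V" and m: "m \<in> W" "\<And>k. k \<in> W \<Longrightarrow> ip (h - m) k = 0"
  shows "proj h = m"
  unfolding orth_projection_def
proof (rule the_equality)
  fix m' assume m': "m' \<in> W \<and> (\<forall>k\<in>W. ip (h - m') k = 0)"
  then have d: "m' - m \<in> W"
    using m(1) by (intro W_diff) auto
  have "ip (m' - m) (m' - m) = ip (h - m) (m' - m) - ip (h - m') (m' - m)"
    using h m m' d W_subset by (simp add: ip_diff subset_iff)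
  also have "\<dots> = 0"
    using m' m(2) d by simp
  finally have "m' - m = 0"
    using d W_subset by (intro ip_definite) auto
  then show "m' = m"
    by simp
qed (use m in blast)

text \<open>Riesz representation of \<open>k \<mapsto> (k | h)\<close> on the subspace gives the projection of \<open>h\<close>.\<close>

lemma proj_exists:
  assumes h: "h \<in> V"
  obtains m where "m \<in> W" "\<And>k. k \<in> W \<Longrightarrow> ip (h - m) k = 0"
proof -
  show ?thesis
  proof (rule riesz_on_subspace[OF W_inner_product_space W_subset, of "\<lambda>k. ip k h" "ip_norm ip h"])
    show "cmod (ip k h) \<le> ip_norm ip h * ip_norm ip k" if "k \<in> W" for k
      using Cauchy_Schwarz[OF subsetD[OF W_subset that] h] by (simp add: mult.commute)
    show "ip (u + v) h = ip u h + ip v h" if "u \<in> W" "v \<in> W" for u v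
      by (rule ip_add[OF that[THEN subsetD[OF W_subset]] h])
    show "ip (fscale c u) h = c * ip u h" if "u \<in> W" for c u
      by (rule ip_fscale[OF subsetD[OF W_subset that] h])
  next
    fix u :: "nat \<Rightarrow> 'x \<Rightarrow> complex" and m
    assume u: "\<And>n. u n \<in> W" and m: "m \<in> V" and lim: "ip_tendsto ip u m"
      and eq: "\<And>k. k \<in> W \<Longrightarrow> ip k h = ip k m"
    have "ip (h - m) k = 0" if k: "k \<in> W" for k
    proof -
      have kV: "k \<in> V"
        using k W_subset by blast
      have "ip h k = ip m k"
        by (simp only: ip_cnj[OF kV h] ip_cnj[OF kV m] eq[OF k])
      then show ?thesis
        using ip_diff[OF h m kV] by simp
    qed
    then show ?thesis
      by (rule that[OF W_closed[OF u m lim]])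
  qed
qed

lemma proj_mem:
  assumes "h \<in> V"
  shows "proj h \<in> W"
proof (rule proj_exists[OF assms])
  fix m assume "m \<in> W" "\<And>k. k \<in> W \<Longrightarrow> ip (h - m) k = 0"
  then show ?thesis
    using proj_eqI[OF assms, of m] by simp
qed

lemma proj_mem_space: "h \<in> V \<Longrightarrow> proj h \<in> V"
  using proj_mem W_subset by blast

lemma proj_orth:
  assumes "h \<in> V" "k \<in> W"
  shows "ip (h - proj h) k = 0"
proof (rule proj_exists[OF assms(1)])
  fix m assume m: "m \<in> W" "\<And>k. k \<in> W \<Longrightarrow> ip (h - m) k = 0"
  then have "proj h = m"
    by (rule proj_eqI[OF assms(1)])
  then show ?thesis
    using m(2)[OF assms(2)] by simp
qed

lemma proj_diff:
  assumes "h \<in> V" "k \<in> V"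
  shows "proj (h - k) = proj h - proj k"
proof (rule proj_eqI[OF diff_mem[OF assms] W_diff[OF assms[THEN proj_mem]]])
  fix l assume l: "l \<in> W"
  have lV: "l \<in> V"
    using l W_subset by blast
  have split: "h - k - (proj h - proj k) = (h - proj h) - (k - proj k)"
    by simp
  have "ip ((h - proj h) - (k - proj k)) l = ip (h - proj h) l - ip (k - proj k) l"
    using assms lV by (intro ip_diff diff_mem proj_mem_space)
  then show "ip (h - k - (proj h - proj k)) l = 0"
    unfolding split by (simp only: proj_orth[OF assms(1) l] proj_orth[OF assms(2) l] diff_self)
qed

end


section \<open>The GNS construction in terms of functions\<close>

definition left_translation :: "'a::complex_star_algebra \<Rightarrow> ('a \<Rightarrow> complex) \<Rightarrow> 'a \<Rightarrow> complex" where
  "left_translation y h = (\<lambda>x. h (y\<^sup>\<star> * x))"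

locale representable_functional =
  fixes f :: "'a::complex_star_algebra \<Rightarrow> complex"
  assumes representable: "representable f"
begin

lemma positive: "positive_functional f"
  using representable by (simp add: representable_def)

sublocale R: reproducing_space "range (assoc_op f)" "ran_ip f" "assoc_op f"
  by (rule reproducing_space_ran[OF positive])

sublocale H: complex_hilbert_space "gns_space f" "gns_ip f"
  using gns_space_completion[OF positive] by (simp add: hilbert_completion_def)

abbreviation "seminorm a \<equiv> ip_norm (gns_ip f) (assoc_op f a)"

lemma assoc_op_mem: "assoc_op f a \<in> gns_space f"
  using R.V_subset_completion by (auto simp: gns_space_def)

lemma gns_spaceE:
  assumes "h \<in> gns_space f"
  obtains a where "R.rep (\<lambda>n. assoc_op f (a n)) h"
proof -
  obtain u where u: "R.rep u h"
    using assms unfolding gns_space_def fn_completion_def by blast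
  have "\<exists>a. u n = assoc_op f a" for n
    using u unfolding represents_def by blast
  then obtain a where "\<And>n. u n = assoc_op f (a n)"
    by metis
  then have "u = (\<lambda>n. assoc_op f (a n))"
    by (simp add: fun_eq_iff)
  then show ?thesis
    using u by (intro that[of a]) simp
qed

lemma rep_mem: "R.rep u h \<Longrightarrow> h \<in> gns_space f"
  unfolding gns_space_def fn_completion_def by blast

lemma rep_ip_tendsto: "R.rep u h \<Longrightarrow> ip_tendsto (gns_ip f) u h"
  unfolding gns_ip_def by (rule R.rep_tendsto)

lemma gns_ip_assoc_op: "gns_ip f (assoc_op f a) (assoc_op f b) = f (b\<^sup>\<star> * a)"
  unfolding gns_ip_def by (simp add: R.cip_extends ran_ip_assoc_op[OF positive])

lemma f_self: "f (a\<^sup>\<star> * a) = of_real ((seminorm a)\<^sup>2)"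
  using H.ip_self[OF assoc_op_mem[of a]] by (simp add: gns_ip_assoc_op)

lemma assoc_op_diff: "assoc_op f (a - b) = assoc_op f a - assoc_op f b"
  using assoc_op_add[OF positive, of "a - b" b] by simp

text \<open>The reproducing property passes from the range of \<open>assoc_op f\<close> to its completion because the
  completion is taken along pointwise limits.\<close>

lemma gns_ip_evaluation:
  assumes "h \<in> gns_space f"
  shows "gns_ip f h (assoc_op f x) = h x"
proof -
  obtain a where a: "R.rep (\<lambda>n. assoc_op f (a n)) h"
    using assms gns_spaceE by blast
  show ?thesis
    unfolding gns_ip_def
  proof (rule R.cip_eqI[OF a R.rep_const])
    show "(\<lambda>n. ran_ip f (assoc_op f (a n)) (assoc_op f x)) \<longlonglongrightarrow> h x"
      using a by (simp add: R.reproducing represents_def)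
  qed simp
qed

text \<open>This is the second condition of representability; the constant is enlarged to be positive so
  that it can be divided by.\<close>

lemma seminorm_mult_le:
  obtains K where "K > 0" "\<And>a. seminorm (y * a) \<le> K * seminorm a"
proof -
  obtain l where l: "l \<ge> 0" "\<And>b. Re (f (b\<^sup>\<star> * y\<^sup>\<star> * y * b)) \<le> l * Re (f (b\<^sup>\<star> * b))"
    using representable unfolding representable_def by metis
  have "seminorm (y * a) \<le> sqrt (l + 1) * seminorm a" for a
  proof -
    have "Re (f ((y * a)\<^sup>\<star> * (y * a))) \<le> l * Re (f (a\<^sup>\<star> * a))"
      using l(2)[of a] by (simp add: star_mult mult.assoc)
    also have "\<dots> \<le> (l + 1) * Re (f (a\<^sup>\<star> * a))"
      using f_pos(2)[OF positive, of a] by (simp add: mult_right_mono)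
    finally show ?thesis
      by (simp add: ip_norm_def gns_ip_assoc_op flip: real_sqrt_mult)
  qed
  then show ?thesis
    using that[of "sqrt (l + 1)"] l(1) by auto
qed

text \<open>The identity \<open>f (x\<^sup>\<star> y a) = f ((y\<^sup>\<star> x)\<^sup>\<star> a)\<close> turns left multiplication by \<open>y\<close> into translation
  of the argument by \<open>y\<^sup>\<star>\<close>, which survives pointwise limits. Hence the operator of the GNS
  representation is a translation on the whole completion.\<close>

lemma left_translation_assoc_op: "left_translation y (assoc_op f a) = assoc_op f (y * a)"
  by (simp add: left_translation_def assoc_op_def star_mult star_star mult.assoc)

lemma rep_left_translation:
  assumes a: "R.rep (\<lambda>n. assoc_op f (a n)) h"
  shows "R.rep (\<lambda>n. assoc_op f (y * a n)) (left_translation y h)"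
  unfolding represents_def
proof (intro conjI allI)
  show "(\<lambda>n. assoc_op f (y * a n) x) \<longlonglongrightarrow> left_translation y h x" for x
    using a unfolding left_translation_assoc_op[symmetric]
    by (simp add: left_translation_def represents_def)
  obtain K where K: "K > 0" "\<And>a. seminorm (y * a) \<le> K * seminorm a"
    using seminorm_mult_le by blast
  have eq: "ip_norm (ran_ip f) (assoc_op f b) = seminorm b" for b
    by (simp add: ip_norm_def gns_ip_assoc_op ran_ip_assoc_op[OF positive])
  show "ip_Cauchy (ran_ip f) (\<lambda>n. assoc_op f (y * a n))"
    unfolding ip_Cauchy_def
  proof (intro allI impI)
    fix e :: real
    assume "e > 0"
    then have "e / K > 0"
      using K(1) by simp
    then obtain N where N: "\<And>m n. m \<ge> N \<Longrightarrow> n \<ge> N \<Longrightarrow> seminorm (a m - a n) < e / K"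
      using a unfolding represents_def ip_Cauchy_def eq assoc_op_diff[symmetric] by meson
    have "seminorm (y * (a m - a n)) < e" if "m \<ge> N" "n \<ge> N" for m n
      using K(2)[of "a m - a n"] N[OF that] K(1) by (simp add: field_simps)
    then show "\<exists>N. \<forall>m\<ge>N. \<forall>n\<ge>N.
        ip_norm (ran_ip f) (assoc_op f (y * a m) - assoc_op f (y * a n)) < e"
      unfolding eq assoc_op_diff[symmetric] right_diff_distrib[symmetric] by blast
  qed
qed simp

lemma left_translation_mem: "h \<in> gns_space f \<Longrightarrow> left_translation y h \<in> gns_space f"
  using gns_spaceE rep_left_translation rep_mem by metis

lemma left_translation_bounded:
  "\<exists>K. \<forall>h\<in>gns_space f. ip_norm (gns_ip f) (left_translation y h) \<le> K * ip_norm (gns_ip f) h"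
proof -
  obtain K where K: "K > 0" "\<And>a. seminorm (y * a) \<le> K * seminorm a"
    using seminorm_mult_le by blast
  have eq: "ip_norm (ran_ip f) (assoc_op f b) = seminorm b" for b
    by (simp add: ip_norm_def gns_ip_assoc_op ran_ip_assoc_op[OF positive])
  have "ip_norm (gns_ip f) (left_translation y h) \<le> K * ip_norm (gns_ip f) h"
    if h: "h \<in> gns_space f" for h
  proof -
    obtain a where a: "R.rep (\<lambda>n. assoc_op f (a n)) h"
      using h gns_spaceE by blast
    have "(\<lambda>n. seminorm (a n)) \<longlonglongrightarrow> ip_norm (gns_ip f) h"
      using R.tendsto_norm_cip[OF a] by (simp only: eq) (simp add: gns_ip_def)
    then have "(\<lambda>n. K * seminorm (a n)) \<longlonglongrightarrow> K * ip_norm (gns_ip f) h"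
      by (rule tendsto_mult_left)
    moreover have "(\<lambda>n. seminorm (y * a n)) \<longlonglongrightarrow> ip_norm (gns_ip f) (left_translation y h)"
      using R.tendsto_norm_cip[OF rep_left_translation[OF a]] by (simp only: eq) (simp add: gns_ip_def)
    ultimately show ?thesis
      using K(2) by (intro LIMSEQ_le) auto
  qed
  then show ?thesis
    by blast
qed

text \<open>Uniqueness holds since a bounded operator is determined by its values on the dense range of
  \<open>assoc_op f\<close>.\<close>

lemma gns_rep_eq: "gns_rep f y = restrict (left_translation y) (gns_space f)"
  unfolding gns_rep_def
proof (rule the_equality)
  let ?S = "restrict (left_translation y) (gns_space f)"
  have "?S (h + k) = ?S h + ?S k" if "h \<in> gns_space f" "k \<in> gns_space f" for h k
    using that H.add_mem[OF that] by (simp add: left_translation_def fun_eq_iff)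
  moreover have "?S (fscale c h) = fscale c (?S h)" if "h \<in> gns_space f" for c h
    using that H.fscale_mem[OF that] by (simp add: left_translation_def fscale_def fun_eq_iff)
  ultimately have "bounded_operator_on (gns_space f) (gns_ip f) ?S"
    using left_translation_bounded[of y] left_translation_mem
    by (simp add: bounded_operator_on_def)
  then show "?S \<in> gns_space f \<rightarrow>\<^sub>E gns_space f \<and> bounded_operator_on (gns_space f) (gns_ip f) ?S \<and>
      (\<forall>a. ?S (assoc_op f a) = assoc_op f (y * a))"
    using left_translation_mem by (auto simp: assoc_op_mem left_translation_assoc_op)
next
  fix T
  assume T: "T \<in> gns_space f \<rightarrow>\<^sub>E gns_space f \<and> bounded_operator_on (gns_space f) (gns_ip f) T \<and>
      (\<forall>a. T (assoc_op f a) = assoc_op f (y * a))"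
  have Tmem: "T h \<in> gns_space f" if "h \<in> gns_space f" for h
    using T that by blast
  have Tdiff: "T (h - k) = T h - T k" if "h \<in> gns_space f" "k \<in> gns_space f" for h k
  proof -
    have "T ((h - k) + k) = T (h - k) + T k"
      using T that H.diff_mem unfolding bounded_operator_on_def by blast
    then show ?thesis
      by simp
  qed
  obtain K where K: "\<And>h. h \<in> gns_space f \<Longrightarrow> ip_norm (gns_ip f) (T h) \<le> K * ip_norm (gns_ip f) h"
    using T unfolding bounded_operator_on_def by blast
  have "T h = left_translation y h" if h: "h \<in> gns_space f" for h
  proof -
    obtain a where a: "R.rep (\<lambda>n. assoc_op f (a n)) h"
      using h gns_spaceE by blast
    have lim: "(\<lambda>n. K * ip_norm (gns_ip f) (assoc_op f (a n) - h)) \<longlonglongrightarrow> 0"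
      using rep_ip_tendsto[OF a] tendsto_mult_right_zero unfolding ip_tendsto_def by blast
    have "norm (ip_norm (gns_ip f) (assoc_op f (y * a n) - T h))
        \<le> K * ip_norm (gns_ip f) (assoc_op f (a n) - h)" for n
      using K[OF H.diff_mem[OF assoc_op_mem h], of "a n"] Tdiff[OF assoc_op_mem h, of "a n"] T
        H.ip_norm_nonneg[OF H.diff_mem[OF assoc_op_mem Tmem[OF h]], of "y * a n"]
      by simp
    then have "ip_tendsto (gns_ip f) (\<lambda>n. assoc_op f (y * a n)) (T h)"
      unfolding ip_tendsto_def
      by (intro Lim_null_comparison[OF _ lim] always_eventually allI)
    then show ?thesis
      using rep_ip_tendsto[OF rep_left_translation[OF a]] Tmem[OF h] left_translation_mem[OF h]
      by (intro H.ip_tendsto_unique[of "\<lambda>n. assoc_op f (y * a n)"]) (simp_all add: assoc_op_mem)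
  qed
  then show "T = restrict (left_translation y) (gns_space f)"
    using T by (intro extensionalityI[of _ "gns_space f"]) (auto simp: PiE_def)
qed

lemma gns_rep_apply: "h \<in> gns_space f \<Longrightarrow> gns_rep f y h = left_translation y h"
  by (simp add: gns_rep_eq)

lemma left_translation_adjoint:
  assumes h: "h \<in> gns_space f" and k: "k \<in> gns_space f"
  shows "gns_ip f (left_translation y h) k = gns_ip f h (left_translation (y\<^sup>\<star>) k)"
proof -
  obtain a where a: "R.rep (\<lambda>n. assoc_op f (a n)) h"
    using h gns_spaceE by blast
  obtain b where b: "R.rep (\<lambda>n. assoc_op f (b n)) k"
    using k gns_spaceE by blast
  have eq: "ran_ip f (assoc_op f (y * a n)) (assoc_op f (b n))
      = ran_ip f (assoc_op f (a n)) (assoc_op f (y\<^sup>\<star> * b n))" for n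
    by (simp add: ran_ip_assoc_op[OF positive] star_mult star_star mult.assoc)
  show ?thesis
    using R.tendsto_cip[OF rep_left_translation[OF a] b, of y]
    unfolding gns_ip_def eq
    by (rule R.cip_eqI[OF a rep_left_translation[OF b], symmetric])
qed

text \<open>The value of the cyclic vector at \<open>x\<close> is its inner product with \<open>assoc_op f x\<close>, hence the
  conjugate of \<open>f x\<close>. That this function belongs to the completion is the Riesz theorem,
  applied to \<open>assoc_op f a \<mapsto> f a\<close>, which is well defined and bounded by
  \<open>\<bar>f a\<bar>\<^sup>2 \<le> C f (a\<^sup>\<star> a)\<close>.\<close>

lemma cnj_mem: "(\<lambda>x. cnj (f x)) \<in> gns_space f"
proof -
  obtain C where C: "C \<ge> 0" "\<And>a. (cmod (f a))\<^sup>2 \<le> C * Re (f (a\<^sup>\<star> * a))"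
    using representable unfolding representable_def by blast
  have bound: "cmod (f a) \<le> sqrt C * seminorm a" for a
    using real_le_rsqrt[OF C(2)[of a]] by (simp add: ip_norm_def gns_ip_assoc_op real_sqrt_mult)
  define L where "L u = f (SOME a. u = assoc_op f a)" for u
  \<comment> \<open>If two elements have the same image under \<open>assoc_op f\<close>, their difference has seminorm \<open>0\<close>, so
    \<open>f\<close> agrees on them.\<close>
  have L: "L (assoc_op f a) = f a" for a
  proof -
    let ?b = "SOME b. assoc_op f a = assoc_op f b"
    have b: "assoc_op f a = assoc_op f ?b"
      by (rule someI) (rule refl)
    have "seminorm (a - ?b) = 0"
      using b H.ip_norm_fscale[OF H.zero_mem, of 0] by (simp add: assoc_op_diff fscale_def zero_fun_def)
    then have "f (a - ?b) = 0"
      using bound[of "a - ?b"] by simp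
    then have "f a = f ?b"
      using f_add[OF positive, of "a - ?b" ?b] by simp
    then show ?thesis
      by (simp add: L_def)
  qed
  have sub: "complex_inner_product_space (range (assoc_op f)) (gns_ip f)"
    using H.inner_product_subspace[of "range (assoc_op f)"] R.zero_mem R.add_mem R.fscale_mem
      assoc_op_mem by blast
  obtain z where z: "z \<in> gns_space f" "\<And>a. f a = gns_ip f (assoc_op f a) z"
  proof (rule H.riesz_on_subspace[OF sub, of L "sqrt C"])
    show "range (assoc_op f) \<subseteq> gns_space f"
      using assoc_op_mem by blast
    show "L (u + v) = L u + L v" if "u \<in> range (assoc_op f)" "v \<in> range (assoc_op f)" for u v
      using that by (auto simp: L f_add[OF positive] simp flip: assoc_op_add[OF positive])
    show "L (fscale c u) = c * L u" if "u \<in> range (assoc_op f)" for c u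
      using that by (auto simp: L f_scaleC[OF positive] simp flip: assoc_op_scaleC[OF positive])
    show "cmod (L u) \<le> sqrt C * ip_norm (gns_ip f) u" if "u \<in> range (assoc_op f)" for u
      using that bound by (auto simp: L)
  next
    fix u z
    assume z: "z \<in> gns_space f" and eq: "\<And>w. w \<in> range (assoc_op f) \<Longrightarrow> L w = gns_ip f w z"
    show thesis
      by (rule that[OF z]) (use eq in \<open>simp flip: L\<close>)
  qed
  have "z x = cnj (f x)" for x
    using gns_ip_evaluation[OF z(1), of x] z(2)[of x] H.ip_cnj[OF z(1) assoc_op_mem, of x] by simp
  then have "z = (\<lambda>x. cnj (f x))"
    by (simp add: fun_eq_iff)
  then show ?thesis
    using z(1) by simp
qed

lemma gns_vector_eq: "gns_vector f = (\<lambda>x. cnj (f x))"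
  unfolding gns_vector_def
proof (rule the_equality)
  have ev: "gns_ip f (assoc_op f a) z = cnj (z a)" if "z \<in> gns_space f" for z a
    using gns_ip_evaluation[OF that, of a] H.ip_cnj[OF that assoc_op_mem, of a] by simp
  show "(\<lambda>x. cnj (f x)) \<in> gns_space f \<and> (\<forall>a. f a = gns_ip f (assoc_op f a) (\<lambda>x. cnj (f x)))"
    using ev[OF cnj_mem] cnj_mem by simp
  show "z = (\<lambda>x. cnj (f x))" if "z \<in> gns_space f \<and> (\<forall>a. f a = gns_ip f (assoc_op f a) z)" for z
    using that ev by (simp add: fun_eq_iff)
qed

lemma gns_vector_mem: "gns_vector f \<in> gns_space f"
  by (simp add: gns_vector_eq cnj_mem)

lemma left_translation_gns_vector: "left_translation a (gns_vector f) = assoc_op f a"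
  using f_cnj[OF positive, of _ a] by (simp add: left_translation_def gns_vector_eq assoc_op_def)

end


section \<open>Mutual absolute continuity\<close>

locale representable_pair = F: representable_functional f + G: representable_functional g
  for f g :: "'a::complex_star_algebra \<Rightarrow> complex"
begin

lemma singular_subspace_subset: "singular_subspace f g \<subseteq> gns_space g"
  by (auto simp: singular_subspace_def)

text \<open>The sequences in the definition can be traded for approximation within every \<open>e\<close>: membership
  says that \<open>(0, z)\<close> lies in the closure of \<open>{(A a, B a) | a}\<close>. In this form closedness needs no
  diagonal sequences.\<close>

lemma singular_subspace_iff:
  "z \<in> singular_subspace f g \<longleftrightarrow> z \<in> gns_space g \<and>
     (\<forall>e>0. \<exists>a. F.seminorm a < e \<and> ip_norm (gns_ip g) (assoc_op g a - z) < e)"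
proof (intro iffI conjI allI impI)
  fix e :: real
  assume z: "z \<in> singular_subspace f g" and e: "e > 0"
  then obtain a where a: "(\<lambda>n. f ((a n)\<^sup>\<star> * a n)) \<longlonglongrightarrow> 0"
    and lim: "(\<lambda>n. ip_norm (gns_ip g) (assoc_op g (a n) - z)) \<longlonglongrightarrow> 0"
    by (auto simp: singular_subspace_def ip_tendsto_def F.gns_ip_assoc_op)
  have "(\<lambda>n. F.seminorm (a n)) \<longlonglongrightarrow> 0"
    using tendsto_real_sqrt[OF tendsto_Re[OF a]] by (simp add: ip_norm_def F.gns_ip_assoc_op)
  then have "\<forall>\<^sub>F n in sequentially. F.seminorm (a n) < e"
    using e by (rule order_tendstoD)
  moreover have "\<forall>\<^sub>F n in sequentially. ip_norm (gns_ip g) (assoc_op g (a n) - z) < e"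
    using lim e by (rule order_tendstoD)
  ultimately have "\<forall>\<^sub>F n in sequentially.
      F.seminorm (a n) < e \<and> ip_norm (gns_ip g) (assoc_op g (a n) - z) < e"
    by (rule eventually_conj)
  then show "\<exists>a. F.seminorm a < e \<and> ip_norm (gns_ip g) (assoc_op g a - z) < e"
    using eventually_happens trivial_limit_sequentially by blast
next
  assume "z \<in> gns_space g \<and>
     (\<forall>e>0. \<exists>a. F.seminorm a < e \<and> ip_norm (gns_ip g) (assoc_op g a - z) < e)"
  then have z: "z \<in> gns_space g"
    and ex: "\<And>e. e > 0 \<Longrightarrow> \<exists>a. F.seminorm a < e \<and> ip_norm (gns_ip g) (assoc_op g a - z) < e"
    by blast+
  have "\<exists>a. F.seminorm a < 1 / Suc n \<and> ip_norm (gns_ip g) (assoc_op g a - z) < 1 / Suc n" for n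
    by (rule ex) simp
  then obtain a where a: "\<And>n. F.seminorm (a n) < 1 / Suc n"
    "\<And>n. ip_norm (gns_ip g) (assoc_op g (a n) - z) < 1 / Suc n"
    by metis
  have inv: "(\<lambda>n. 1 / real (Suc n)) \<longlonglongrightarrow> 0"
    using LIMSEQ_inverse_real_of_nat by (simp add: inverse_eq_divide)
  have "norm (F.seminorm (a n)) \<le> 1 / Suc n" for n
    using a(1)[of n] F.H.ip_norm_nonneg[OF F.assoc_op_mem, of "a n"] by simp
  then have "(\<lambda>n. F.seminorm (a n)) \<longlonglongrightarrow> 0"
    by (intro Lim_null_comparison[OF _ inv] always_eventually allI)
  then have "(\<lambda>n. complex_of_real ((F.seminorm (a n))\<^sup>2)) \<longlonglongrightarrow> of_real (0\<^sup>2)"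
    by (intro tendsto_intros)
  then have "(\<lambda>n. gns_ip f (assoc_op f (a n)) (assoc_op f (a n))) \<longlonglongrightarrow> 0"
    by (simp add: F.gns_ip_assoc_op F.f_self)
  moreover have "norm (ip_norm (gns_ip g) (assoc_op g (a n) - z)) \<le> 1 / Suc n" for n
    using a(2)[of n] G.H.ip_norm_nonneg[OF G.H.diff_mem[OF G.assoc_op_mem z], of "a n"] by simp
  then have "ip_tendsto (gns_ip g) (\<lambda>n. assoc_op g (a n)) z"
    unfolding ip_tendsto_def by (intro Lim_null_comparison[OF _ inv] always_eventually allI)
  ultimately show "z \<in> singular_subspace f g"
    using z by (auto simp: singular_subspace_def)
qed (use singular_subspace_subset in blast)

lemma singular_subspaceD:
  assumes "z \<in> singular_subspace f g" "e > 0"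
  obtains a where "F.seminorm a < e" "ip_norm (gns_ip g) (assoc_op g a - z) < e"
  using assms singular_subspace_iff by blast

sublocale M: closed_subspace "gns_space g" "gns_ip g" "singular_subspace f g"
proof
  show "singular_subspace f g \<subseteq> gns_space g"
    by (rule singular_subspace_subset)
  show "0 \<in> singular_subspace f g"
    unfolding singular_subspace_iff
  proof (intro conjI allI impI G.H.zero_mem)
    fix e :: real
    assume e: "e > 0"
    have "assoc_op f 0 = 0" "assoc_op g 0 = 0"
      using F.assoc_op_diff[of 0 0] G.assoc_op_diff[of 0 0] by simp_all
    then show "\<exists>a. F.seminorm a < e \<and> ip_norm (gns_ip g) (assoc_op g a - 0) < e"
      using e F.H.ip_norm_fscale[OF F.H.zero_mem, of 0] G.H.ip_norm_fscale[OF G.H.zero_mem, of 0]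
      by (intro exI[of _ 0]) (simp add: fscale_def zero_fun_def)
  qed
next
  fix z w assume z: "z \<in> singular_subspace f g" and w: "w \<in> singular_subspace f g"
  then have mem: "z \<in> gns_space g" "w \<in> gns_space g"
    using singular_subspace_subset by auto
  show "z + w \<in> singular_subspace f g"
    unfolding singular_subspace_iff
  proof (intro conjI allI impI G.H.add_mem mem)
    fix e :: real
    assume "e > 0"
    then have e: "e / 2 > 0"
      by simp
    obtain a where a: "F.seminorm a < e / 2" "ip_norm (gns_ip g) (assoc_op g a - z) < e / 2"
      using singular_subspaceD[OF z e] .
    obtain b where b: "F.seminorm b < e / 2" "ip_norm (gns_ip g) (assoc_op g b - w) < e / 2"
      using singular_subspaceD[OF w e] .
    have "F.seminorm (a + b) < e"
      using F.H.ip_norm_triangle[OF F.assoc_op_mem F.assoc_op_mem, of a b] a b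
      by (simp add: assoc_op_add[OF F.positive])
    moreover have split: "assoc_op g (a + b) - (z + w) = (assoc_op g a - z) + (assoc_op g b - w)"
      by (simp add: assoc_op_add[OF G.positive])
    have "ip_norm (gns_ip g) (assoc_op g (a + b) - (z + w)) < e"
      using G.H.ip_norm_triangle[OF G.H.diff_mem[OF G.assoc_op_mem mem(1)]
          G.H.diff_mem[OF G.assoc_op_mem mem(2)], of a b] a b
      unfolding split by linarith
    ultimately show "\<exists>a. F.seminorm a < e \<and> ip_norm (gns_ip g) (assoc_op g a - (z + w)) < e"
      by blast
  qed
next
  fix c z assume z: "z \<in> singular_subspace f g"
  then have mem: "z \<in> gns_space g"
    using singular_subspace_subset by auto
  show "fscale c z \<in> singular_subspace f g"
    unfolding singular_subspace_iff
  proof (intro conjI allI impI G.H.fscale_mem mem)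
    fix e :: real
    assume "e > 0"
    then have e: "e / (cmod c + 1) > 0"
      by (simp add: add_nonneg_pos)
    obtain a where a: "F.seminorm a < e / (cmod c + 1)"
      "ip_norm (gns_ip g) (assoc_op g a - z) < e / (cmod c + 1)"
      using singular_subspaceD[OF z e] .
    have small: "cmod c * t < e" if "0 \<le> t" "t < e / (cmod c + 1)" for t
    proof -
      have "cmod c * t \<le> (cmod c + 1) * t"
        using that by (simp add: mult_right_mono)
      also have "\<dots> < e"
        using that by (simp add: pos_less_divide_eq add_nonneg_pos mult.commute)
      finally show ?thesis .
    qed
    have "F.seminorm (c *\<^sub>C a) < e"
      using small[OF F.H.ip_norm_nonneg[OF F.assoc_op_mem] a(1)]
      by (simp add: assoc_op_scaleC[OF F.positive] F.H.ip_norm_fscale F.assoc_op_mem)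
    moreover have "assoc_op g (c *\<^sub>C a) - fscale c z = fscale c (assoc_op g a - z)"
      by (simp add: assoc_op_scaleC[OF G.positive] fscale_def fun_eq_iff algebra_simps)
    then have "ip_norm (gns_ip g) (assoc_op g (c *\<^sub>C a) - fscale c z) < e"
      using small[OF G.H.ip_norm_nonneg[OF G.H.diff_mem[OF G.assoc_op_mem mem]] a(2)]
      by (simp add: G.H.ip_norm_fscale G.H.diff_mem G.assoc_op_mem mem)
    ultimately show "\<exists>a. F.seminorm a < e \<and> ip_norm (gns_ip g) (assoc_op g a - fscale c z) < e"
      by blast
  qed
next
  fix s :: "nat \<Rightarrow> 'a \<Rightarrow> complex" and z
  assume s: "\<And>n. s n \<in> singular_subspace f g" and z: "z \<in> gns_space g"
    and lim: "ip_tendsto (gns_ip g) s z"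
  have smem: "s n \<in> gns_space g" for n
    using s singular_subspace_subset by blast
  show "z \<in> singular_subspace f g"
    unfolding singular_subspace_iff
  proof (intro conjI allI impI z)
    fix e :: real
    assume "e > 0"
    then have e: "e / 2 > 0"
      by simp
    have "\<forall>\<^sub>F n in sequentially. ip_norm (gns_ip g) (s n - z) < e / 2"
      using lim e unfolding ip_tendsto_def by (rule order_tendstoD)
    then obtain n where n: "ip_norm (gns_ip g) (s n - z) < e / 2"
      using eventually_happens trivial_limit_sequentially by blast
    obtain a where a: "F.seminorm a < e / 2" "ip_norm (gns_ip g) (assoc_op g a - s n) < e / 2"
      using singular_subspaceD[OF s e] .
    have "ip_norm (gns_ip g) (assoc_op g a - z) < e"
      using G.H.ip_norm_diff_triangle[OF G.assoc_op_mem smem z, of a n] a n by simp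
    then show "\<exists>a. F.seminorm a < e \<and> ip_norm (gns_ip g) (assoc_op g a - z) < e"
      using a(1) \<open>e > 0\<close> by (intro exI[of _ a]) simp
  qed
qed

text \<open>Left multiplication by \<open>y\<close> is bounded for both seminorms, so it maps approximating elements
  for \<open>z\<close> to approximating elements for the translate of \<open>z\<close>.\<close>

lemma left_translation_singular:
  assumes z: "z \<in> singular_subspace f g"
  shows "left_translation y z \<in> singular_subspace f g"
proof -
  have mem: "z \<in> gns_space g"
    using z singular_subspace_subset by auto
  obtain K where K: "K > 0" "\<And>a. F.seminorm (y * a) \<le> K * F.seminorm a"
    using F.seminorm_mult_le by blast
  obtain L where L: "\<And>h. h \<in> gns_space g \<Longrightarrow>
      ip_norm (gns_ip g) (left_translation y h) \<le> L * ip_norm (gns_ip g) h"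
    using G.left_translation_bounded by blast
  show ?thesis
    unfolding singular_subspace_iff
  proof (intro conjI allI impI G.left_translation_mem mem)
    fix e :: real
    assume e: "e > 0"
    define B where "B = max K L"
    have B: "B > 0" "K \<le> B" "L \<le> B"
      using K(1) by (auto simp: B_def)
    obtain a where a: "F.seminorm a < e / B" "ip_norm (gns_ip g) (assoc_op g a - z) < e / B"
      using singular_subspaceD[OF z, of "e / B"] e B(1) by auto
    have "F.seminorm (y * a) \<le> B * F.seminorm a"
      using K(2)[of a] mult_right_mono[OF B(2) F.H.ip_norm_nonneg[OF F.assoc_op_mem, of a]] by simp
    then have "F.seminorm (y * a) < e"
      using a(1) B(1) by (simp add: pos_less_divide_eq mult.commute)
    moreover have "assoc_op g (y * a) - left_translation y z = left_translation y (assoc_op g a - z)"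
      by (simp add: left_translation_def fun_eq_iff flip: G.left_translation_assoc_op)
    then have "ip_norm (gns_ip g) (assoc_op g (y * a) - left_translation y z)
        \<le> B * ip_norm (gns_ip g) (assoc_op g a - z)"
      using L[OF G.H.diff_mem[OF G.assoc_op_mem mem], of a]
        mult_right_mono[OF B(3) G.H.ip_norm_nonneg[OF G.H.diff_mem[OF G.assoc_op_mem mem]], of a]
      by simp
    then have "ip_norm (gns_ip g) (assoc_op g (y * a) - left_translation y z) < e"
      using a(2) B(1) by (simp add: pos_less_divide_eq mult.commute)
    ultimately show "\<exists>a. F.seminorm a < e \<and>
        ip_norm (gns_ip g) (assoc_op g a - left_translation y z) < e"
      by blast
  qed
qed

text \<open>A subspace that is invariant under a family of operators closed under adjoints is reducing: its
  projection commutes with the family.\<close>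

lemma proj_left_translation:
  assumes h: "h \<in> gns_space g"
  shows "M.proj (left_translation y h) = left_translation y (M.proj h)"
proof (rule M.proj_eqI[OF G.left_translation_mem[OF h] left_translation_singular[OF M.proj_mem[OF h]]])
  fix k assume k: "k \<in> singular_subspace f g"
  have "left_translation y h - left_translation y (M.proj h) = left_translation y (h - M.proj h)"
    by (simp add: left_translation_def fun_eq_iff)
  then have "gns_ip g (left_translation y h - left_translation y (M.proj h)) k
      = gns_ip g (h - M.proj h) (left_translation (y\<^sup>\<star>) k)"
    using G.left_translation_adjoint[OF G.H.diff_mem[OF h M.proj_mem_space[OF h]], of k y] k
      singular_subspace_subset by auto
  also have "\<dots> = 0"
    using M.proj_orth[OF h left_translation_singular[OF k]] .
  finally show "gns_ip g (left_translation y h - left_translation y (M.proj h)) k = 0" .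
qed

text \<open>Commuting the projection past the representation, which moves the cyclic vector to
  \<open>assoc_op g a\<close>, identifies the seminorm of the absolutely continuous part with the distance of
  \<open>assoc_op g a\<close> from the singular subspace.\<close>

lemma ac_part_self:
  "ac_part f g (a\<^sup>\<star> * a) = of_real ((ip_norm (gns_ip g) (assoc_op g a - M.proj (assoc_op g a)))\<^sup>2)"
proof -
  let ?z = "gns_vector g - M.proj (gns_vector g)"
  have z: "?z \<in> gns_space g"
    using G.gns_vector_mem by (intro G.H.diff_mem M.proj_mem_space)
  have az: "left_translation a ?z \<in> gns_space g"
    using z by (rule G.left_translation_mem)
  have "left_translation (a\<^sup>\<star> * a) ?z = left_translation (a\<^sup>\<star>) (left_translation a ?z)"
    by (simp add: left_translation_def star_mult mult.assoc)
  then have "ac_part f g (a\<^sup>\<star> * a) = gns_ip g (left_translation a ?z) (left_translation a ?z)"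
    using G.left_translation_adjoint[OF az z, of "a\<^sup>\<star>"]
    by (simp add: ac_part_def Let_def G.gns_rep_apply[OF z] star_star)
  moreover have "left_translation a ?z
      = left_translation a (gns_vector g) - left_translation a (M.proj (gns_vector g))"
    by (simp add: left_translation_def fun_eq_iff)
  then have "left_translation a ?z = assoc_op g a - M.proj (assoc_op g a)"
    by (simp only: proj_left_translation[OF G.gns_vector_mem, symmetric] G.left_translation_gns_vector)
  ultimately show ?thesis
    using G.H.ip_self[OF az] by simp
qed

text \<open>The components \<open>u n\<close> and \<open>v n\<close> of \<open>assoc_op f (a n)\<close> and \<open>assoc_op g (a n)\<close> orthogonal to
  the two singular subspaces form a pair that is again approximable by pairs
  \<open>(assoc_op f d, assoc_op g d)\<close>. If \<open>u n\<close> tends to \<open>0\<close>, the limit of \<open>v n\<close> is therefore singular,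
  yet it is orthogonal to the singular subspace.\<close>

lemma ac_part_absolutely_continuous: "ac_part f g \<lless> ac_part g f"
  unfolding absolutely_continuous_wrt_def
proof (intro allI impI)
  interpret S: representable_pair g f
    by unfold_locales
  fix a :: "nat \<Rightarrow> 'a"
  assume fa: "(\<lambda>n. ac_part g f ((a n)\<^sup>\<star> * a n)) \<longlonglongrightarrow> 0"
    and ga: "((\<lambda>(n, m). ac_part f g ((a n - a m)\<^sup>\<star> * (a n - a m))) \<longlongrightarrow> 0)
      (sequentially \<times>\<^sub>F sequentially)"
  let ?nf = "ip_norm (gns_ip f)" and ?ng = "ip_norm (gns_ip g)"
  define u where "u n = assoc_op f (a n) - S.M.proj (assoc_op f (a n))" for n
  define v where "v n = assoc_op g (a n) - M.proj (assoc_op g (a n))" for n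
  have u: "u n \<in> gns_space f" for n
    unfolding u_def by (intro F.H.diff_mem S.M.proj_mem_space F.assoc_op_mem)
  have v: "v n \<in> gns_space g" for n
    unfolding v_def by (intro G.H.diff_mem M.proj_mem_space G.assoc_op_mem)
  have u0: "(\<lambda>n. ?nf (u n)) \<longlonglongrightarrow> 0"
    using tendsto_real_sqrt[OF tendsto_Re[OF fa]] F.H.ip_norm_nonneg[OF u]
    by (simp add: S.ac_part_self flip: u_def)
  have "ip_Cauchy (gns_ip g) v"
    unfolding ip_Cauchy_def
  proof (intro allI impI)
    fix e :: real
    assume e: "e > 0"
    have "v n - v m = assoc_op g (a n - a m) - M.proj (assoc_op g (a n - a m))" for n m
      by (simp add: v_def G.assoc_op_diff M.proj_diff G.assoc_op_mem)
    then have vd: "ac_part f g ((a n - a m)\<^sup>\<star> * (a n - a m)) = of_real ((?ng (v n - v m))\<^sup>2)" for n m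
      by (simp only: ac_part_self)
    have "\<forall>\<^sub>F p in sequentially \<times>\<^sub>F sequentially.
        dist (case p of (n, m) \<Rightarrow> complex_of_real ((?ng (v n - v m))\<^sup>2)) 0 < e\<^sup>2"
      using tendstoD[OF ga, of "e\<^sup>2"] e unfolding vd by simp
    then obtain N where N: "\<And>n m. n \<ge> N \<Longrightarrow> m \<ge> N \<Longrightarrow> (?ng (v n - v m))\<^sup>2 < e\<^sup>2"
      by (auto simp: eventually_prod_sequentially norm_power)
    have "?ng (v m - v n) < e" if "m \<ge> N" "n \<ge> N" for m n
      using N[OF that] e by (simp add: power2_less_imp_less)
    then show "\<exists>N. \<forall>m\<ge>N. \<forall>n\<ge>N. ?ng (v m - v n) < e"
      by blast
  qed
  then obtain z where z: "z \<in> gns_space g" and lim: "ip_tendsto (gns_ip g) v z"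
    using G.H.complete[of v] v by blast
  have "z \<in> singular_subspace f g"
    unfolding singular_subspace_iff
  proof (intro conjI allI impI z)
    fix e :: real
    assume "e > 0"
    then have e: "e / 3 > 0"
      by simp
    have "\<forall>\<^sub>F n in sequentially. ?nf (u n) < e / 3"
      using u0 e by (rule order_tendstoD)
    moreover have "\<forall>\<^sub>F n in sequentially. ?ng (v n - z) < e / 3"
      using lim e unfolding ip_tendsto_def by (rule order_tendstoD)
    ultimately have "\<forall>\<^sub>F n in sequentially. ?nf (u n) < e / 3 \<and> ?ng (v n - z) < e / 3"
      by (rule eventually_conj)
    then obtain n where n: "?nf (u n) < e / 3" "?ng (v n - z) < e / 3"
      using eventually_happens trivial_limit_sequentially by blast
    let ?p = "S.M.proj (assoc_op f (a n))" and ?q = "M.proj (assoc_op g (a n))"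
    have p: "?p \<in> singular_subspace g f" "?p \<in> gns_space f"
      by (intro S.M.proj_mem S.M.proj_mem_space F.assoc_op_mem)+
    have q: "?q \<in> singular_subspace f g" "?q \<in> gns_space g"
      by (intro M.proj_mem M.proj_mem_space G.assoc_op_mem)+
    \<comment> \<open>The element \<open>b\<close> removes \<open>?p\<close> and hardly changes the \<open>g\<close> side; \<open>c\<close> removes \<open>?q\<close> and hardly
      changes the \<open>f\<close> side.\<close>
    obtain b where b: "G.seminorm b < e / 3" "?nf (assoc_op f b - ?p) < e / 3"
      using S.singular_subspaceD[OF p(1) e] .
    obtain c where c: "F.seminorm c < e / 3" "?ng (assoc_op g c - ?q) < e / 3"
      using singular_subspaceD[OF q(1) e] .
    have split: "assoc_op f (a n - b - c) = u n - (assoc_op f b - ?p) - assoc_op f c"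
      by (simp add: u_def F.assoc_op_diff)
    have "F.seminorm (a n - b - c) < e"
      using F.H.ip_norm_diff_le[OF F.H.diff_mem[OF u F.H.diff_mem[OF F.assoc_op_mem p(2)]]
          F.assoc_op_mem, of n b c]
        F.H.ip_norm_diff_le[OF u F.H.diff_mem[OF F.assoc_op_mem p(2)], of n b] n b c
      unfolding split by linarith
    moreover have split': "assoc_op g (a n - b - c) - z
        = (v n - z) - assoc_op g b - (assoc_op g c - ?q)"
      by (simp add: v_def G.assoc_op_diff)
    have "?ng (assoc_op g (a n - b - c) - z) < e"
      using G.H.ip_norm_diff_le[OF G.H.diff_mem[OF G.H.diff_mem[OF v z] G.assoc_op_mem]
          G.H.diff_mem[OF G.assoc_op_mem q(2)], of n b c]
        G.H.ip_norm_diff_le[OF G.H.diff_mem[OF v z] G.assoc_op_mem, of n b] n b c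
      unfolding split' by linarith
    ultimately show "\<exists>a. F.seminorm a < e \<and> ?ng (assoc_op g a - z) < e"
      by blast
  qed
  moreover have "gns_ip g z k = 0" if k: "k \<in> singular_subspace f g" for k
  proof -
    have "gns_ip g (v n) k = 0" for n
      unfolding v_def by (intro M.proj_orth G.assoc_op_mem k)
    moreover have "(\<lambda>n. gns_ip g (v n) k) \<longlonglongrightarrow> gns_ip g z k"
      by (rule G.H.tendsto_ip_left[OF v z _ lim]) (use k singular_subspace_subset in blast)
    ultimately show ?thesis
      by (simp add: LIMSEQ_const_iff)
  qed
  ultimately have "z = 0"
    using G.H.ip_definite z by blast
  then have "(\<lambda>n. ?ng (v n)) \<longlonglongrightarrow> 0"
    using lim by (simp add: ip_tendsto_def)
  then have "(\<lambda>n. complex_of_real ((?ng (v n))\<^sup>2)) \<longlonglongrightarrow> of_real (0\<^sup>2)"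
    by (intro tendsto_intros)
  then show "(\<lambda>n. ac_part f g ((a n)\<^sup>\<star> * a n)) \<longlonglongrightarrow> 0"
    by (simp add: ac_part_self flip: v_def)
qed

end

theorem theorem4p2:
  fixes f g :: "'a::complex_star_algebra \<Rightarrow> complex"
  assumes "representable f" and "representable g"
  shows "ac_part g f \<lless> ac_part f g \<and> ac_part f g \<lless> ac_part g f"
proof -
  interpret representable_pair f g
    by unfold_locales (fact assms)+
  interpret S: representable_pair g f
    by unfold_locales
  show ?thesis
    using ac_part_absolutely_continuous S.ac_part_absolutely_continuous by blast
qed

end
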